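(* Suppose $\mathrm{supp}(\mathbb{P}^* )\subseteq[\hat{\mathbf{u}}^{(0)},\hat{\mathbf{u}}^{(N+1)}]$. Then, with probability at least $1-\alpha$ with respect to the sampling, the family $\{\mathcal{U}^{DY}_\epsilon:0<\epsilon<1\}$ simultaneously implies a probabilistic guarantee for $\mathbb{P}^*$, where $\mathcal{U}^{DY}_\epsilon$ is the set of all $\mathbf{u}\in[\hat{\mathbf{u}}^{(0)},\hat{\mathbf{u}}^{(N+1)}]$ for which there exist $\lambda\in\mathbb{R}$, $\mathbf{w},\mathbf{m}\in\mathbb{R}^d$, $\mathbf{A},\hat{\mathbf{A}}\succeq\mathbf{0}$ such that $$\lambda\le\frac1\epsilon,\qquad(\lambda-1)\hat{\mathbf{u}}^{(0)}\le\mathbf{m}\le(\lambda-1)\hat{\mathbf{u}}^{(N+1)},$$ $$\begin{pmatrix}\lambda-1&\mathbf{m}^T\\\mathbf{m}&\mathbf{A}\end{pmatrix}\succeq\mathbf{0},\qquad\begin{pmatrix}1&\mathbf{u}^T\\\mathbf{u}&\hat{\mathbf{A}}\end{pmatrix}\succeq\mathbf{0},$$ $$\lambda\hat{\boldsymbol\mu}=\mathbf{m}+\mathbf{u}+\mathbf{w},\qquad\|\mathbf{C}\mathbf{w}\|\le\lambda\sqrt{\gamma_1^B},$$ $$\lambda(\gamma_2^B\hat{\boldsymbol\Sigma}+\hat{\boldsymbol\mu}\hat{\boldsymbol\mu}^T)-\mathbf{A}-\hat{\mathbf{A}}-\mathbf{w}\hat{\boldsymbol\mu}^T-\hat{\boldsymbol\mu}\mathbf{w}^T\succeq\mathbf{0},$$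 with $\mathbf{C}^T\mathbf{C}=\hat{\boldsymbol\Sigma}^{-1}$ a Cholesky decomposition and $\gamma_1^B,\gamma_2^B$ computed by bootstrap. Moreover, $$\delta^*(\mathbf{v}\mid\mathcal{U}^{DY}_\epsilon)=\sup_{\mathbb{P}\in\mathcal{P}^{DY}}\mathrm{VaR}^{\mathbb{P}}_\epsilon(\mathbf{v})=\inf\ t$$ where the infimum is over $t,r,s,\theta\in\mathbb{R}$, $\mathbf{q},\mathbf{y}_1,\mathbf{y}_1^\pm,\mathbf{y}_2,\mathbf{y}_2^\pm\in\mathbb{R}^d$ and symmetric $\mathbf{Z}\in\mathbb{R}^{d\times d}$ subject to $$r+s\le\theta\epsilon,$$ $$\begin{pmatrix}r+\mathbf{y}_1^{+T}\hat{\mathbf{u}}^{(0)}-\mathbf{y}_1^{-T}\hat{\mathbf{u}}^{(N+1)}&\frac12(\mathbf{q}-\mathbf{y}_1)^T\\\frac12(\mathbf{q}-\mathbf{y}_1)&\mathbf{Z}\end{pmatrix}\succeq\mathbf{0},$$ $$\begin{pmatrix}r+\mathbf{y}_2^{+T}\hat{\mathbf{u}}^{(0)}-\mathbf{y}_2^{-T}\hat{\mathbf{u}}^{(N+1)}+t-\theta&\frac12(\mathbf{q}-\mathbf{y}_2-\mathbf{v})^T\\\frac12(\mathbf{q}-\mathbf{y}_2-\mathbf{v})&\mathbf{Z}\end{pmatrix}\succeq\mathbf{0},$$ $$s\ge(\gamma_2^B\hat{\boldsymbol\Sigma}+\hat{\boldsymbol\mu}\hat{\boldsymbol\mu}^T)\circ\mathbf{Z}+\hat{\boldsymbol\mu}^T\mathbf{q}+\sqrt{\gamma_1^B}\,\|\mathbf{q}+2\mathbf{Z}\hat{\boldsymbol\mu}\|_{\hat{\boldsymbol\Sigma}^{-1}},$$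 $$\mathbf{y}_1=\mathbf{y}_1^+-\mathbf{y}_1^-,\quad\mathbf{y}_2=\mathbf{y}_2^+-\mathbf{y}_2^-,\quad\mathbf{y}_1^+,\mathbf{y}_1^-,\mathbf{y}_2^+,\mathbf{y}_2^-\ge\mathbf{0},\ \theta\ge0.$$
   Context: $0<\alpha<1$, $0<\epsilon<1$; $\mathcal{S}$ is a sample of $N$ points drawn i.i.d. from the unknown measure $\mathbb{P}^*$ on $\mathbb{R}^d$; $\tilde{\mathbf{u}}$ is a random vector. $[\hat{\mathbf{u}}^{(0)},\hat{\mathbf{u}}^{(N+1)}]=\{\mathbf{u}:\hat u_i^{(0)}\le u_i\le\hat u_i^{(N+1)}\ \forall i\}$ is a known finite box. $\hat{\boldsymbol\mu},\hat{\boldsymbol\Sigma}$ are the sample mean and sample covariance of $\mathcal{S}$, with $\hat{\boldsymbol\Sigma}$ invertible. $\mathbf{M}\circ\mathbf{Z}=\mathrm{trace}(\mathbf{M}^T\mathbf{Z})$; $\|\cdot\|$ is the Euclidean norm and, for a positive definite matrix $\mathbf{M}$, $\|\mathbf{x}\|_{\mathbf{M}}=\sqrt{\mathbf{x}^T\mathbf{M}\mathbf{x}}$; $\succeq\mathbf{0}$ means symmetric positive semidefinite; vector inequalities are componentwise. $\gamma_1^B,\gamma_2^B$ are thresholds, computed by the bootstrap, for the test of the hypothesis that $\mathbb{P}^*$ has mean $\boldsymbol\mu_0$ and covariance $\boldsymbol\Sigma_0$ using the statistics $(\hat{\boldsymbol\mu}-\boldsymbol\mu_0)^T\hat{\boldsymbol\Sigma}^{-1}(\hat{\boldsymbol\mu}-\boldsymbol\mu_0)$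 and $\max_{\boldsymbol\lambda}\frac{\boldsymbol\lambda^T(\boldsymbol\Sigma_0+(\boldsymbol\mu_0-\hat{\boldsymbol\mu})(\boldsymbol\mu_0-\hat{\boldsymbol\mu})^T)\boldsymbol\lambda}{\boldsymbol\lambda^T\hat{\boldsymbol\Sigma}\boldsymbol\lambda}$, respectively. The confidence region of this test is $$\mathcal{P}^{DY}=\{\mathbb{P}\text{ Borel probability on }[\hat{\mathbf{u}}^{(0)},\hat{\mathbf{u}}^{(N+1)}]:\ (\mathbb{E}^{\mathbb{P}}[\tilde{\mathbf{u}}]-\hat{\boldsymbol\mu})^T\hat{\boldsymbol\Sigma}^{-1}(\mathbb{E}^{\mathbb{P}}[\tilde{\mathbf{u}}]-\hat{\boldsymbol\mu})\le\gamma_1^B,\ \mathbb{E}^{\mathbb{P}}[(\tilde{\mathbf{u}}-\hat{\boldsymbol\mu})(\tilde{\mathbf{u}}-\hat{\boldsymbol\mu})^T]\preceq\gamma_2^B\hat{\boldsymbol\Sigma}\}.$$ Standing assumption: the test with these thresholds is treated as valid at level $\alpha$, i.e. $\mathbb{P}^*\in\mathcal{P}^{DY}$ with probability at least $1-\alpha$ with respect to the sampling. $\mathrm{VaR}_\epsilon^{\mathbb{P}}(\mathbf{v})=\inf\{t:\mathbb{P}(\tilde{\mathbf{u}}^T\mathbf{v}\le t)\ge1-\epsilon\}$; $\delta^*(\mathbf{v}\mid\mathcal{U})=\sup_{\mathbf{u}\in\mathcal{U}}\mathbf{v}^T\mathbf{u}$. A set $\mathcal{U}$ implies a probabilistic guarantee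 for $\mathbb{P}^*$ at level $\epsilon$ if for every $\mathbf{x}^*\in\mathbb{R}^k$ and every function $f(\mathbf{u},\mathbf{x})$ concave in $\mathbf{u}$ for all $\mathbf{x}$: $f(\mathbf{u},\mathbf{x}^* )\le0\ \forall\mathbf{u}\in\mathcal{U}$ implies $\mathbb{P}^*(f(\tilde{\mathbf{u}},\mathbf{x}^* )\le0)\ge1-\epsilon$. A family $\{\mathcal{U}_\epsilon:0<\epsilon<1\}$ simultaneously implies a probabilistic guarantee for $\mathbb{P}^*$ if for every $0<\epsilon<1$ the set $\mathcal{U}_\epsilon$ implies one at level $\epsilon$.
   Formalization: In the constraint on s, the norm of q + 2Zμ̂ is weighted by Σ̂ instead of Σ̂^{-1}; with ‖x‖_M = √(xᵀMx) the printed weight makes the last equality false (e.g. d=1, Σ̂=1/2). *)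

theory Defs
  imports "HOL-Probability.Probability"
begin

subsection \<open>Matrices\<close>

definition psd :: "real^'n^'n \<Rightarrow> bool" where
  "psd A \<longleftrightarrow> transpose A = A \<and> (\<forall>x. 0 \<le> x \<bullet> (A *v x))"

definition outer :: "real^'n \<Rightarrow> real^'m \<Rightarrow> real^'m^'n" where
  "outer x y = (\<chi> i j. x $ i * y $ j)"

definition frob :: "real^'n^'n \<Rightarrow> real^'n^'n \<Rightarrow> real" where
  "frob A B = trace (transpose A ** B)"

definition wnorm :: "real^'n^'n \<Rightarrow> real^'n \<Rightarrow> real" where
  "wnorm A x = sqrt (x \<bullet> (A *v x))"

text \<open>The block matrix with corner entry \<open>a\<close>, off-diagonal blocks \<open>b\<close> and its transpose, and
  lower right block \<open>A\<close>. The index \<open>None\<close> is the additional row and column.\<close>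

definition bordered :: "real \<Rightarrow> real^'n \<Rightarrow> real^'n^'n \<Rightarrow> real^('n option)^('n option)" where
  "bordered a b A = (\<chi> i j. case i of
       None \<Rightarrow> (case j of None \<Rightarrow> a | Some l \<Rightarrow> b $ l)
     | Some k \<Rightarrow> (case j of None \<Rightarrow> b $ k | Some l \<Rightarrow> A $ k $ l))"

subsection \<open>Samples and probabilistic statements\<close>

definition sample_mean :: "nat \<Rightarrow> (nat \<Rightarrow> 'a \<Rightarrow> real^'d) \<Rightarrow> 'a \<Rightarrow> real^'d" where
  "sample_mean N X \<omega> = (1 / real N) *\<^sub>R (\<Sum>i<N. X i \<omega>)"

definition sample_cov :: "nat \<Rightarrow> (nat \<Rightarrow> 'a \<Rightarrow> real^'d) \<Rightarrow> 'a \<Rightarrow> real^'d^'d" where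
  "sample_cov N X \<omega> = (1 / (real N - 1)) *\<^sub>R
     (\<Sum>i<N. outer (X i \<omega> - sample_mean N X \<omega>) (X i \<omega> - sample_mean N X \<omega>))"

text \<open>The set of outcomes satisfying \<open>Q\<close> need not be measurable, so the statement that \<open>Q\<close> holds
  with probability at least \<open>p\<close> is expressed through a measurable subset. For a measurable event
  this is the usual notion.\<close>

definition with_prob_at_least :: "'a measure \<Rightarrow> real \<Rightarrow> ('a \<Rightarrow> bool) \<Rightarrow> bool" where
  "with_prob_at_least M p Q \<longleftrightarrow> (\<exists>E\<in>sets M. (\<forall>\<omega>\<in>E. Q \<omega>) \<and> p \<le> measure M E)"

definition msupp :: "'b::topological_space measure \<Rightarrow> 'b set" where
  "msupp P = {u. \<forall>V. open V \<and> u \<in> V \<longrightarrow> 0 < emeasure P V}"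

subsection \<open>Value at risk, support functions, probabilistic guarantees\<close>

text \<open>A distribution of the random vector is a Borel measure \<open>P\<close> on the whole space, and the random
  vector itself is the identity.\<close>

definition VaR :: "real \<Rightarrow> (real^'d) measure \<Rightarrow> real^'d \<Rightarrow> real" where
  "VaR \<epsilon> P v = Inf {t. 1 - \<epsilon> \<le> measure P {u. u \<bullet> v \<le> t}}"

text \<open>Extended real valued, so that the supremum over the empty set is \<open>-\<infinity>\<close>.\<close>

definition support_fun :: "real^'d \<Rightarrow> (real^'d) set \<Rightarrow> ereal" where
  "support_fun v U = (SUP u\<in>U. ereal (v \<bullet> u))"

text \<open>The type argument fixes the dimension of the decision vector \<open>x\<close>.\<close>

definition implies_guarantee ::
    "'k::finite itself \<Rightarrow> (real^'d) measure \<Rightarrow> real \<Rightarrow> (real^'d) set \<Rightarrow> bool" where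
  "implies_guarantee k P \<epsilon> U \<longleftrightarrow>
     (\<forall>(x::real^'k) (f :: real^'d \<Rightarrow> real^'k \<Rightarrow> real).
        (\<forall>y. concave_on UNIV (\<lambda>u. f u y)) \<longrightarrow> (\<forall>u\<in>U. f u x \<le> 0) \<longrightarrow>
        1 - \<epsilon> \<le> measure P {u. f u x \<le> 0})"

definition simultaneously_implies_guarantee ::
    "'k::finite itself \<Rightarrow> (real^'d) measure \<Rightarrow> (real \<Rightarrow> (real^'d) set) \<Rightarrow> bool" where
  "simultaneously_implies_guarantee k P U \<longleftrightarrow>
     (\<forall>\<epsilon>. 0 < \<epsilon> \<and> \<epsilon> < 1 \<longrightarrow> implies_guarantee k P \<epsilon> (U \<epsilon>))"

subsection \<open>The confidence region, the uncertainty set and the dual program\<close>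

text \<open>The box is \<open>{lo..hi}\<close>; the order on vectors is componentwise.\<close>

definition P_DY :: "real^'d \<Rightarrow> real^'d \<Rightarrow> real^'d \<Rightarrow> real^'d^'d \<Rightarrow> real \<Rightarrow> real \<Rightarrow>
    (real^'d) measure set" where
  "P_DY lo hi \<mu> \<Sigma> \<gamma>1 \<gamma>2 = {P. sets P = sets borel \<and> prob_space P \<and> measure P {lo..hi} = 1 \<and>
     ((\<integral>u. u \<partial>P) - \<mu>) \<bullet> (matrix_inv \<Sigma> *v ((\<integral>u. u \<partial>P) - \<mu>)) \<le> \<gamma>1 \<and>
     psd (\<gamma>2 *\<^sub>R \<Sigma> - (\<integral>u. outer (u - \<mu>) (u - \<mu>) \<partial>P))}"

definition U_DY :: "real^'d \<Rightarrow> real^'d \<Rightarrow> real^'d \<Rightarrow> real^'d^'d \<Rightarrow> real^'d^'d \<Rightarrow> real \<Rightarrow> real \<Rightarrow>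
    real \<Rightarrow> (real^'d) set" where
  "U_DY lo hi \<mu> \<Sigma> C \<gamma>1 \<gamma>2 \<epsilon> = {u \<in> {lo..hi}. \<exists>(l::real) w m A B.
     psd A \<and> psd B \<and>
     l \<le> 1 / \<epsilon> \<and> (l - 1) *\<^sub>R lo \<le> m \<and> m \<le> (l - 1) *\<^sub>R hi \<and>
     psd (bordered (l - 1) m A) \<and> psd (bordered 1 u B) \<and>
     l *\<^sub>R \<mu> = m + u + w \<and> norm (C *v w) \<le> l * sqrt \<gamma>1 \<and>
     psd (l *\<^sub>R (\<gamma>2 *\<^sub>R \<Sigma> + outer \<mu> \<mu>) - A - B - outer w \<mu> - outer \<mu> w)}"

text \<open>The last term of the constraint on \<open>s\<close> is the support function of the ellipsoid
  \<open>{x. x \<bullet> (matrix_inv \<Sigma> *v x) \<le> \<gamma>1}\<close> of admissible deviations of the mean from \<open>\<mu>\<close>, evaluated at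
  \<open>q + 2 Z \<mu>\<close>. With \<open>wnorm A x = sqrt (x \<bullet> (A *v x))\<close>, this support function is the norm
  weighted by \<open>\<Sigma>\<close>, not by its inverse.\<close>

definition dual_DY :: "real^'d \<Rightarrow> real^'d \<Rightarrow> real^'d \<Rightarrow> real^'d^'d \<Rightarrow> real \<Rightarrow> real \<Rightarrow>
    real \<Rightarrow> real^'d \<Rightarrow> real set" where
  "dual_DY lo hi \<mu> \<Sigma> \<gamma>1 \<gamma>2 \<epsilon> v = {t. \<exists>r s \<theta> q y1 y1p y1m y2 y2p y2m Z.
     transpose Z = Z \<and>
     r + s \<le> \<theta> * \<epsilon> \<and>
     psd (bordered (r + y1p \<bullet> lo - y1m \<bullet> hi) ((1/2) *\<^sub>R (q - y1)) Z) \<and>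
     psd (bordered (r + y2p \<bullet> lo - y2m \<bullet> hi + t - \<theta>) ((1/2) *\<^sub>R (q - y2 - v)) Z) \<and>
     s \<ge> frob (\<gamma>2 *\<^sub>R \<Sigma> + outer \<mu> \<mu>) Z + \<mu> \<bullet> q + sqrt \<gamma>1 * wnorm \<Sigma> (q + 2 *\<^sub>R (Z *v \<mu>)) \<and>
     y1 = y1p - y1m \<and> y2 = y2p - y2m \<and>
     0 \<le> y1p \<and> 0 \<le> y1m \<and> 0 \<le> y2p \<and> 0 \<le> y2m \<and> 0 \<le> \<theta>}"

end

theory Submission
  imports Defs
begin

text \<open>
  Both the guarantee and the two equalities rest on one observation: the constraints that define
  the uncertainty set say exactly that some two-point law \<open>p \<delta>\<^sub>u + (1 - p) \<delta>\<^sub>m\<close> with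
  \<open>p \<ge> \<epsilon>\<close> and both atoms in the box lies in the confidence region (lemma \<open>in_U_DY_iff\<close>, with
  \<open>p = 1 / \<lambda>\<close>). The matrices \<open>A\<close> and \<open>B\<close> of the program may dominate the second moments of the
  atoms instead of being equal to them, because the region bounds the second moment only from above.

  Given a law \<open>Q\<close> in the region and an open convex set \<open>B\<close> with \<open>Q(B) > \<epsilon>\<close>, replace \<open>Q\<close> on \<open>B\<close>
  and on its complement by the conditional means. The mean is unchanged and the second moment can
  only shrink, so the resulting two-point law is still in the region, and its atom in \<open>B\<close> belongs to
  the uncertainty set (\<open>U_DY_meets_open_convex\<close>). Applied to \<open>B = {f > 0}\<close> with \<open>f\<close> concave this
  yields the probabilistic guarantee for every law in the region, hence for the true one on the event
  that the region covers it. Applied to half-spaces it bounds the value at risk by the support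
  function. For the opposite bound, the two-point law of a point \<open>u\<close> of the uncertainty set has value
  at risk at least \<open>v \<bullet> u\<close> as soon as \<open>p > \<epsilon>\<close>; if \<open>p = \<epsilon>\<close>, one moves \<open>u\<close> slightly towards \<open>m\<close>
  and increases its mass so that the mean is kept.

  The dual program is the search for a convex quadratic \<open>g\<close> that is nonnegative on the box, is at
  least \<open>\<theta> + v \<bullet> u - t\<close> there, and whose expectation under every admissible pair of moments is at
  most \<open>\<theta> \<epsilon>\<close> (\<open>in_dual_DY_iff\<close>); the variables \<open>y\<^sup>+\<close> and \<open>y\<^sup>-\<close> are multipliers of the box
  constraints (\<open>box_multipliers\<close>), and \<open>s\<close> bounds the largest expectation of the part of \<open>g\<close> without
  the constant. Weak duality follows by integrating \<open>g\<close> against a two-point law. For strong duality,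
  a value \<open>t\<close> above the support function makes the compact convex set of moment vectors of laws on
  two labelled copies of the box disjoint from the closed convex set of vectors that would certify
  \<open>v \<bullet> u \<ge> t\<close>; a strictly separating hyperplane is a dual solution, up to a rescaling
  (\<open>separating_multipliers\<close>, \<open>strong_duality\<close>). Compactness of the box takes the place of a Slater
  condition, so there is no duality gap even if the region is empty.
\<close>

section \<open>Positive semidefinite matrices and rank-one matrices\<close>

lemma compact_box: "compact {lo..hi::real^'n}"
  and convex_box: "convex {lo..hi::real^'n}"
  by (simp_all add: interval_cbox_cart)

lemma outer_mv: "outer x y *v z = (y \<bullet> z) *\<^sub>R x"
  by (simp add: vec_eq_iff outer_def matrix_vector_mult_def inner_vec_def sum_distrib_left mult_ac)

lemma frob_eq_inner: "frob A B = A \<bullet> B"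
proof -
  have "frob A B = (\<Sum>i\<in>UNIV. \<Sum>k\<in>UNIV. A $ k $ i * B $ k $ i)"
    by (simp add: frob_def trace_def transpose_def matrix_matrix_mult_def)
  also have "\<dots> = A \<bullet> B" by (subst sum.swap) (simp add: inner_vec_def)
  finally show ?thesis .
qed

lemma outer_inner: "outer x y \<bullet> Z = x \<bullet> (Z *v y)"
  by (simp add: outer_def inner_vec_def matrix_vector_mult_def sum_distrib_left mult_ac)

lemma transpose_outer: "transpose (outer x y) = outer y x"
  by (simp add: transpose_def outer_def vec_eq_iff mult_ac)

lemma transpose_add: "transpose (A + B) = transpose A + transpose (B::real^'n^'m)"
  and transpose_diff: "transpose (A - B) = transpose A - transpose (B::real^'n^'m)"
  and transpose_scaleR: "transpose (c *\<^sub>R A) = c *\<^sub>R transpose (A::real^'n^'m)"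
  by (simp_all add: transpose_def vec_eq_iff)

lemma outer_linear:
  "outer (x + x') y = outer x y + outer x' y"  "outer x (y + y') = outer x y + outer x y'"
  "outer (x - x') y = outer x y - outer x' y"  "outer x (y - y') = outer x y - outer x y'"
  "outer (c *\<^sub>R x) y = c *\<^sub>R outer x y"  "outer x (c *\<^sub>R y) = c *\<^sub>R outer x y"
  by (simp_all add: outer_def vec_eq_iff algebra_simps)

lemma scaleR_mv: "(c *\<^sub>R A) *v x = c *\<^sub>R (A *v (x::real^'n))"
  by (simp add: scaleR_matrix_vector_assoc)

lemmas mv_simps = matrix_vector_mult_add_rdistrib matrix_vector_mult_diff_rdistrib scaleR_mv outer_mv

lemma psd_zero: "psd 0"
  by (simp add: psd_def transpose_def vec_eq_iff)

lemma psd_outer: "psd (outer z z)"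
  by (simp add: psd_def transpose_outer outer_mv inner_commute)

lemma psd_add: "psd A \<Longrightarrow> psd B \<Longrightarrow> psd (A + B)"
  by (simp add: psd_def transpose_add mv_simps inner_add_right)

lemma psd_scaleR: "psd A \<Longrightarrow> 0 \<le> c \<Longrightarrow> psd (c *\<^sub>R A)"
  by (simp add: psd_def transpose_scaleR mv_simps)

lemma symmetric_mv: "transpose Z = Z \<Longrightarrow> x \<bullet> (Z *v y) = y \<bullet> (Z *v (x::real^'n))"
  by (metis dot_lmul_matrix inner_commute transpose_matrix_vector)

lemma quadratic_form_add:
  fixes Z :: "real^'n^'n"
  assumes "transpose Z = Z"
  shows "(x + y) \<bullet> (Z *v (x + y)) = x \<bullet> (Z *v x) + 2 * (y \<bullet> (Z *v x)) + y \<bullet> (Z *v y)"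
  using symmetric_mv[OF assms, of x y]
  by (simp add: matrix_vector_right_distrib inner_add_left inner_add_right)

text \<open>A nonzero off-diagonal entry in the row of a zero diagonal entry would make the form
  unboundedly negative along a line in direction \<open>axis i 1\<close>.\<close>

lemma psd_zero_diagonal:
  assumes A: "psd A" and i: "A $ i $ i = 0"
  shows "A $ i $ j = 0"
proof (rule ccontr)
  assume nz: "A $ i $ j \<noteq> 0"
  have sym: "transpose A = A" using A by (simp add: psd_def)
  have e: "axis k 1 \<bullet> (A *v axis l 1) = A $ k $ l" for k l
    by (simp add: inner_axis' matrix_vector_mult_basis column_def)
  \<comment> \<open>The form at \<open>axis j 1 + s *\<^sub>R axis i 1\<close> is affine in \<open>s\<close>; this \<open>s\<close> gives it the value \<open>- 1\<close>.\<close>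
  define s where "s = - (A $ j $ j + 1) / (2 * A $ i $ j)"
  have "0 \<le> (axis j 1 + s *\<^sub>R axis i 1) \<bullet> (A *v (axis j 1 + s *\<^sub>R axis i 1))"
    using A by (simp add: psd_def)
  also have "\<dots> = A $ j $ j + 2 * s * A $ i $ j"
    by (subst quadratic_form_add[OF sym])
       (simp add: e i matrix_vector_mult_scaleR)
  also have "\<dots> = - 1" using nz by (simp add: s_def field_simps)
  finally show False by simp
qed

text \<open>The Frobenius product of a rank-one matrix \<open>outer z z\<close> with \<open>Z\<close> is the form of \<open>Z\<close> at \<open>z\<close>.
  Eliminating one diagonal entry at a time, as in a Cholesky decomposition, writes \<open>A\<close> as a sum of
  such matrices; the number of nonzero rows drops in every step.\<close>

lemma psd_inner_psd_nonneg:
  fixes A Z :: "real^'n^'n"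
  assumes "psd A" and Z: "psd Z"
  shows "0 \<le> A \<bullet> Z"
  using assms(1)
proof (induction "card {i. A $ i \<noteq> 0}" arbitrary: A rule: less_induct)
  case less
  have sym: "transpose A = A" using less.prems by (simp add: psd_def)
  have e: "axis k 1 \<bullet> (A *v axis l 1) = A $ k $ l" for k l
    by (simp add: inner_axis' matrix_vector_mult_basis column_def)
  show ?case
  proof (cases "A = 0")
    case False
    then obtain i where i: "A $ i \<noteq> 0" by (auto simp: vec_eq_iff[of A])
    then have nz: "A $ i $ i \<noteq> 0"
      using psd_zero_diagonal[OF less.prems] by (metis vec_eq_iff zero_index)
    have "0 \<le> A $ i $ i"
      using less.prems e[of i i] by (metis psd_def)
    with nz have pos: "0 < A $ i $ i" by simp
    have col: "(A *v axis i 1) $ k = A $ k $ i" for k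
      by (simp add: matrix_vector_mult_basis column_def)
    have rowcol: "A $ k $ i = A $ i $ k" for k
      using sym by (metis transpose_def vec_lambda_beta)
    define c where "c = 1 / A $ i $ i"
    define B where "B = A - c *\<^sub>R outer (A *v axis i 1) (A *v axis i 1)"
    have Bent: "B $ k $ l = A $ k $ l - c * A $ i $ k * A $ i $ l" for k l
      by (simp add: B_def outer_def col rowcol)
    have "psd B" unfolding psd_def
    proof (intro conjI allI)
      show "transpose B = B"
        by (simp add: B_def transpose_diff transpose_scaleR transpose_outer sym)
      fix x
      \<comment> \<open>Completing the square: the form of \<open>B\<close> at \<open>x\<close> is the minimum of the form of \<open>A\<close> on the
         line through \<open>x\<close> in direction \<open>axis i 1\<close>, attained at \<open>s\<close>.\<close>
      define s where "s = - c * (x \<bullet> (A *v axis i 1))"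
      have "0 \<le> (x + s *\<^sub>R axis i 1) \<bullet> (A *v (x + s *\<^sub>R axis i 1))"
        using less.prems by (simp add: psd_def)
      also have "\<dots> = x \<bullet> (A *v x) + 2 * s * (x \<bullet> (A *v axis i 1)) + s * s * A $ i $ i"
        using symmetric_mv[OF sym, of "axis i 1" x]
        by (subst quadratic_form_add[OF sym]) (simp add: e matrix_vector_mult_scaleR)
      also have "\<dots> = x \<bullet> (B *v x)"
        using pos
        by (simp add: B_def mv_simps inner_diff_right s_def c_def field_simps
            inner_commute[of "A *v axis i 1"])
      finally show "0 \<le> x \<bullet> (B *v x)" .
    qed
    moreover have "card {k. B $ k \<noteq> 0} < card {k. A $ k \<noteq> 0}"
    proof (rule psubset_card_mono)
      have "B $ i = 0" using pos by (simp add: vec_eq_iff Bent c_def)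
      moreover have "B $ k = 0" if "A $ k = 0" for k
        using that rowcol[of k] by (simp add: vec_eq_iff Bent)
      ultimately show "{k. B $ k \<noteq> 0} \<subset> {k. A $ k \<noteq> 0}"
        using i by blast
    qed simp
    ultimately have "0 \<le> B \<bullet> Z" using less.hyps by blast
    moreover have "A \<bullet> Z = B \<bullet> Z + c * ((A *v axis i 1) \<bullet> (Z *v (A *v axis i 1)))"
      by (simp add: B_def inner_diff_left outer_inner)
    moreover have "0 \<le> (A *v axis i 1) \<bullet> (Z *v (A *v axis i 1))" using Z by (simp add: psd_def)
    moreover have "0 \<le> c" using pos by (simp add: c_def)
    ultimately show ?thesis by simp
  qed simp
qed

lemma UNIV_option_sum:
  fixes f :: "'n::finite option \<Rightarrow> real"
  shows "(\<Sum>i\<in>UNIV. f i) = f None + (\<Sum>i\<in>UNIV. f (Some i))"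
  by (simp add: UNIV_option_conv sum.reindex)

text \<open>A vector indexed by the \<open>option\<close> type is a scalar \<open>c\<close> together with a vector \<open>x\<close>, so the form of
  a bordered matrix is a homogenized quadratic polynomial.\<close>

lemma psd_bordered_iff:
  "psd (bordered a b A) \<longleftrightarrow> transpose A = A \<and>
     (\<forall>c x. 0 \<le> a * c\<^sup>2 + 2 * c * (b \<bullet> x) + x \<bullet> (A *v x))"
proof -
  have T: "transpose (bordered a b A) = bordered a b A \<longleftrightarrow> transpose A = A"
  proof -
    have "transpose (bordered a b A) = bordered a b A \<longleftrightarrow>
       (\<forall>i j. bordered a b A $ j $ i = bordered a b A $ i $ j)"
      by (simp add: vec_eq_iff transpose_def)
    also have "\<dots> \<longleftrightarrow> (\<forall>i j. A $ j $ i = A $ i $ j)"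
      by (auto simp: bordered_def split_option_all)
    finally show ?thesis by (simp add: vec_eq_iff transpose_def)
  qed
  have form: "y \<bullet> (bordered a b A *v y) =
      a * (y $ None)\<^sup>2 + 2 * y $ None * (b \<bullet> x) + x \<bullet> (A *v x)"
    if "x = (\<chi> i. y $ Some i)" for y x
    by (simp add: that inner_vec_def matrix_vector_mult_def bordered_def UNIV_option_sum
        sum_distrib_left sum.distrib algebra_simps power2_eq_square)
  have *: "(\<forall>y. 0 \<le> y \<bullet> (bordered a b A *v y)) \<longleftrightarrow>
     (\<forall>c x. 0 \<le> a * c\<^sup>2 + 2 * c * (b \<bullet> x) + x \<bullet> (A *v x))"
  proof safe
    fix c x assume "\<forall>y. 0 \<le> y \<bullet> (bordered a b A *v y)"
    then have "0 \<le> (\<chi> i. case i of None \<Rightarrow> c | Some k \<Rightarrow> x $ k) \<bullet>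
       (bordered a b A *v (\<chi> i. case i of None \<Rightarrow> c | Some k \<Rightarrow> x $ k))" by blast
    then show "0 \<le> a * c\<^sup>2 + 2 * c * (b \<bullet> x) + x \<bullet> (A *v x)"
      by (subst (asm) form[of x]) (simp_all add: vec_eq_iff)
  next
    fix y assume "\<forall>c x. 0 \<le> a * c\<^sup>2 + 2 * c * (b \<bullet> x) + x \<bullet> (A *v x)"
    then show "0 \<le> y \<bullet> (bordered a b A *v y)" by (subst form[OF refl]) blast
  qed
  show ?thesis unfolding psd_def[of "bordered a b A"] T * ..
qed

text \<open>Writing the border as \<open>a *\<^sub>R m\<close> keeps the Schur complement meaningful when the corner entry
  \<open>a\<close> is zero.\<close>

lemma psd_bordered_Schur:
  assumes "psd (bordered a (a *\<^sub>R m) A)"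
  shows "psd (A - a *\<^sub>R outer m m)"
proof -
  have *: "transpose A = A" "\<And>c x. 0 \<le> a * c\<^sup>2 + 2 * c * ((a *\<^sub>R m) \<bullet> x) + x \<bullet> (A *v x)"
    using assms by (auto simp: psd_bordered_iff)
  have "0 \<le> x \<bullet> ((A - a *\<^sub>R outer m m) *v x)" for x
    using *(2)[of "- (m \<bullet> x)" x]
    by (simp add: mv_simps inner_diff_right inner_commute power2_eq_square algebra_simps)
  with *(1) show ?thesis by (simp add: psd_def transpose_diff transpose_scaleR transpose_outer)
qed

lemma psd_bordered_outer:
  assumes "0 \<le> a"
  shows "psd (bordered a (a *\<^sub>R m) (a *\<^sub>R outer m m))"
proof -
  have "a * c\<^sup>2 + 2 * c * ((a *\<^sub>R m) \<bullet> x) + x \<bullet> ((a *\<^sub>R outer m m) *v x) = a * (c + m \<bullet> x)\<^sup>2" for c x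
    by (simp add: mv_simps inner_commute power2_eq_square algebra_simps)
  with assms show ?thesis by (simp add: psd_bordered_iff transpose_scaleR transpose_outer)
qed

section \<open>The ellipsoid of means and the admissible moments\<close>

locale factored_covariance =
  fixes \<mu> :: "real^'d" and \<Sigma> C :: "real^'d^'d" and \<gamma>1 \<gamma>2 :: real and lo hi :: "real^'d"
  assumes invertible_cov: "invertible \<Sigma>"
    and factor: "transpose C ** C = matrix_inv \<Sigma>"
    and gamma1_nonneg: "0 \<le> \<gamma>1"
begin

lemma inv_cov_form: "x \<bullet> (matrix_inv \<Sigma> *v y) = (C *v x) \<bullet> (C *v y)"
proof -
  have "(C *v x) \<bullet> (C *v y) = x \<bullet> (transpose C *v (C *v y))"
    by (metis dot_lmul_matrix transpose_matrix_vector transpose_transpose)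
  then show ?thesis by (simp add: matrix_vector_mul_assoc factor)
qed

lemma inv_cov_left: "matrix_inv \<Sigma> ** \<Sigma> = mat 1"
  using invertible_cov unfolding invertible_def matrix_inv_def
  by (rule someI_ex[THEN conjunct2])

lemma inv_cov_cov: "matrix_inv \<Sigma> *v (\<Sigma> *v x) = x"
  by (simp add: matrix_vector_mul_assoc inv_cov_left)

lemma symmetric_cov: "transpose \<Sigma> = \<Sigma>"
proof -
  have "transpose (matrix_inv \<Sigma>) = matrix_inv \<Sigma>"
    by (metis factor matrix_transpose_mul transpose_transpose)
  then have "transpose \<Sigma> ** matrix_inv \<Sigma> = mat 1"
    by (metis inv_cov_left matrix_transpose_mul transpose_mat)
  then show ?thesis
    by (metis inv_cov_left matrix_mul_assoc matrix_mul_lid matrix_mul_rid)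
qed

lemma Mahalanobis_le_iff: "x \<bullet> (matrix_inv \<Sigma> *v x) \<le> \<gamma>1 \<longleftrightarrow> norm (C *v x) \<le> sqrt \<gamma>1"
  using real_sqrt_le_iff[of "(C *v x) \<bullet> (C *v x)" \<gamma>1]
  by (simp add: inv_cov_form norm_eq_sqrt_inner)

lemma norm_factor_cov: "norm (C *v (\<Sigma> *v b)) = wnorm \<Sigma> b"
proof -
  have "(C *v (\<Sigma> *v b)) \<bullet> (C *v (\<Sigma> *v b)) = b \<bullet> (\<Sigma> *v b)"
    by (metis inv_cov_form inv_cov_cov inner_commute)
  then show ?thesis by (simp add: wnorm_def norm_eq_sqrt_inner)
qed

text \<open>\<open>b \<bullet> d\<close> is the inner product of \<open>C d\<close> and \<open>C \<Sigma> b\<close>, and the latter vector has length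
  \<open>wnorm \<Sigma> b\<close>; the bound is the Cauchy-Schwarz inequality, with equality at nonnegative multiples of \<open>\<Sigma> b\<close>.\<close>

lemma ellipsoid_support_le:
  assumes "norm (C *v d) \<le> sqrt \<gamma>1"
  shows "b \<bullet> d \<le> sqrt \<gamma>1 * wnorm \<Sigma> b"
proof -
  have "b \<bullet> d = (C *v d) \<bullet> (C *v (\<Sigma> *v b))"
    by (metis inv_cov_form inv_cov_cov inner_commute)
  also have "\<dots> \<le> norm (C *v d) * norm (C *v (\<Sigma> *v b))" by (rule norm_cauchy_schwarz)
  also have "\<dots> \<le> sqrt \<gamma>1 * wnorm \<Sigma> b"
    unfolding norm_factor_cov using assms norm_factor_cov[of b]
    by (metis mult_right_mono norm_ge_zero)
  finally show ?thesis .
qed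

lemma ellipsoid_support_attained:
  obtains d where "norm (C *v d) \<le> sqrt \<gamma>1" "b \<bullet> d = sqrt \<gamma>1 * wnorm \<Sigma> b"
proof (cases "wnorm \<Sigma> b = 0")
  case True
  show ?thesis by (rule that[of 0]) (use True gamma1_nonneg in simp_all)
next
  case False
  have sq: "b \<bullet> (\<Sigma> *v b) = (wnorm \<Sigma> b)\<^sup>2"
    by (metis norm_factor_cov power2_norm_eq_inner inv_cov_form inv_cov_cov inner_commute)
  have nn: "0 \<le> wnorm \<Sigma> b" by (metis norm_factor_cov norm_ge_zero)
  show ?thesis
    by (rule that[of "(sqrt \<gamma>1 / wnorm \<Sigma> b) *\<^sub>R (\<Sigma> *v b)"])
       (use False nn gamma1_nonneg in
         \<open>simp_all add: matrix_vector_mult_scaleR norm_factor_cov sq power2_eq_square\<close>)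
qed

text \<open>\<open>A\<close> stands for the uncentred second moment, so that both constraints of the confidence region
  become convex in the pair \<open>(x, A)\<close> and refer to the law only through its moments.\<close>

definition admissible_moments :: "real^'d \<Rightarrow> real^'d^'d \<Rightarrow> bool" where
  "admissible_moments x A \<longleftrightarrow> norm (C *v (x - \<mu>)) \<le> sqrt \<gamma>1 \<and>
     psd (\<gamma>2 *\<^sub>R \<Sigma> - (A - outer \<mu> x - outer x \<mu> + outer \<mu> \<mu>))"

lemma admissible_moments_mono:
  assumes "admissible_moments x A" "psd (A - A')"
  shows "admissible_moments x A'"
proof -
  have "\<gamma>2 *\<^sub>R \<Sigma> - (A' - outer \<mu> x - outer x \<mu> + outer \<mu> \<mu>) =
      (\<gamma>2 *\<^sub>R \<Sigma> - (A - outer \<mu> x - outer x \<mu> + outer \<mu> \<mu>)) + (A - A')" by simp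
  with assms show ?thesis unfolding admissible_moments_def by (metis psd_add)
qed

text \<open>The law with mass \<open>p\<close> at \<open>u\<close> and \<open>1 - p\<close> at \<open>m\<close> meets the moment constraints.\<close>

definition admissible_two_point :: "real \<Rightarrow> real^'d \<Rightarrow> real^'d \<Rightarrow> bool" where
  "admissible_two_point p u m \<longleftrightarrow> admissible_moments (p *\<^sub>R u + (1 - p) *\<^sub>R m)
     (p *\<^sub>R outer u u + (1 - p) *\<^sub>R outer m m)"

text \<open>Dividing the defining constraints by \<open>\<lambda> = 1 / p\<close> turns them into the moment constraints for the
  two-point law: \<open>m / (\<lambda> - 1)\<close> is the second atom, \<open>- w / \<lambda>\<close> is the deviation of the mean from \<open>\<mu>\<close>, and
  by the Schur complement \<open>A\<close> and \<open>B\<close> dominate the scaled second moments of the atoms, which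
  therefore satisfy the same upper bound. Conversely, equality in these dominations is feasible.\<close>

lemma in_U_DY_iff:
  assumes "0 < \<epsilon>" "\<epsilon> < 1"
  shows "u \<in> U_DY lo hi \<mu> \<Sigma> C \<gamma>1 \<gamma>2 \<epsilon> \<longleftrightarrow> u \<in> {lo..hi} \<and>
     (\<exists>p m. \<epsilon> \<le> p \<and> p \<le> 1 \<and> m \<in> {lo..hi} \<and> admissible_two_point p u m)" (is "?L \<longleftrightarrow> ?R")
proof
  assume ?L
  then obtain l w m A B where u: "u \<in> {lo..hi}" and psdAB: "psd A" "psd B"
    and l: "l \<le> 1 / \<epsilon>" and m: "(l - 1) *\<^sub>R lo \<le> m" "m \<le> (l - 1) *\<^sub>R hi"
    and bA: "psd (bordered (l - 1) m A)" and bB: "psd (bordered 1 u B)"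
    and mean: "l *\<^sub>R \<mu> = m + u + w" and w: "norm (C *v w) \<le> l * sqrt \<gamma>1"
    and cov: "psd (l *\<^sub>R (\<gamma>2 *\<^sub>R \<Sigma> + outer \<mu> \<mu>) - A - B - outer w \<mu> - outer \<mu> w)"
    unfolding U_DY_def by blast
  have l1: "1 \<le> l"
    using bA[unfolded psd_bordered_iff, THEN conjunct2, rule_format, of 1 0] by simp
  obtain m' where m': "m' \<in> {lo..hi}" "m = (l - 1) *\<^sub>R m'"
  proof (cases "l = 1")
    case True
    \<comment> \<open>The second atom has mass zero; any point of the box serves.\<close>
    with m have "m = 0" by auto
    with True u show ?thesis by (intro that[of u]) auto
  next
    case False
    with l1 have "l - 1 > 0" by simp
    show ?thesis
    proof (rule that[of "(1 / (l - 1)) *\<^sub>R m"])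
      show "(1 / (l - 1)) *\<^sub>R m \<in> {lo..hi}"
        using m \<open>l - 1 > 0\<close> by (auto simp: less_eq_vec_def field_simps)
    qed (use False in simp)
  qed
  have sA: "psd (A - (l - 1) *\<^sub>R outer m' m')"
    using bA unfolding m'(2) by (rule psd_bordered_Schur)
  have sB: "psd (B - outer u u)" using psd_bordered_Schur[of 1 u B] bB by simp
  define p where "p = 1 / l"
  have lp: "l * p = 1" "p \<ge> 0" using l1 by (simp_all add: p_def)
  have "u + (l - 1) *\<^sub>R m' = l *\<^sub>R \<mu> - w" using mean m'(2) by simp
  then have "p *\<^sub>R (u + (l - 1) *\<^sub>R m') = p *\<^sub>R (l *\<^sub>R \<mu> - w)" by simp
  then have x: "p *\<^sub>R u + (1 - p) *\<^sub>R m' = \<mu> - p *\<^sub>R w"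
    using lp by (simp add: algebra_simps)
  have n: "norm (C *v (\<mu> - p *\<^sub>R w - \<mu>)) \<le> sqrt \<gamma>1"
  proof -
    have "norm (C *v (\<mu> - p *\<^sub>R w - \<mu>)) = p * norm (C *v w)"
      using lp(2) by (simp add: matrix_vector_mult_scaleR flip: scaleR_minus_right)
        (simp add: vec.neg matrix_vector_mult_scaleR)
    also have "\<dots> \<le> p * (l * sqrt \<gamma>1)" using w lp(2) by (rule mult_left_mono)
    finally show ?thesis using lp(1) by (metis mult.assoc mult.commute mult.right_neutral)
  qed
  have "\<gamma>2 *\<^sub>R \<Sigma> - (p *\<^sub>R outer u u + (1 - p) *\<^sub>R outer m' m' - outer \<mu> (\<mu> - p *\<^sub>R w)
        - outer (\<mu> - p *\<^sub>R w) \<mu> + outer \<mu> \<mu>)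
     = p *\<^sub>R ((l *\<^sub>R (\<gamma>2 *\<^sub>R \<Sigma> + outer \<mu> \<mu>) - A - B - outer w \<mu> - outer \<mu> w)
        + (A - (l - 1) *\<^sub>R outer m' m') + (B - outer u u))"
    using lp(1) by (simp add: outer_linear algebra_simps)
  moreover have "psd \<dots>" using lp(2) cov sA sB by (intro psd_scaleR psd_add)
  ultimately have "admissible_two_point p u m'"
    unfolding admissible_two_point_def admissible_moments_def x using n by simp
  moreover have "\<epsilon> \<le> p" "p \<le> 1"
    using l l1 assms by (simp_all add: p_def field_simps)
  ultimately show ?R using u m'(1) by blast
next
  assume ?R
  then obtain p m where u: "u \<in> {lo..hi}" and p: "\<epsilon> \<le> p" "p \<le> 1" and m: "m \<in> {lo..hi}"
    and tp: "admissible_two_point p u m" by blast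
  define l where "l = 1 / p"
  have lp: "l * p = 1" "p > 0" "l \<ge> 1" "l \<le> 1 / \<epsilon>"
    using p assms by (simp_all add: l_def field_simps)
  define x where "x = p *\<^sub>R u + (1 - p) *\<^sub>R m"
  define w where "w = l *\<^sub>R (\<mu> - x)"
  have mean: "l *\<^sub>R \<mu> = (l - 1) *\<^sub>R m + u + w"
    using lp(1) by (simp add: w_def x_def algebra_simps)
  have n: "norm (C *v (x - \<mu>)) \<le> sqrt \<gamma>1"
    and c: "psd (\<gamma>2 *\<^sub>R \<Sigma> - (p *\<^sub>R outer u u + (1 - p) *\<^sub>R outer m m - outer \<mu> x
        - outer x \<mu> + outer \<mu> \<mu>))"
    using tp unfolding admissible_two_point_def admissible_moments_def x_def by auto
  have "norm (C *v w) = l * norm (C *v (x - \<mu>))"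
    using lp by (simp add: w_def matrix_vector_mult_scaleR matrix_vector_mult_diff_distrib
        norm_minus_commute)
  then have w: "norm (C *v w) \<le> l * sqrt \<gamma>1" using n lp by simp
  have "l *\<^sub>R (\<gamma>2 *\<^sub>R \<Sigma> + outer \<mu> \<mu>) - (l - 1) *\<^sub>R outer m m - outer u u - outer w \<mu> - outer \<mu> w
     = l *\<^sub>R (\<gamma>2 *\<^sub>R \<Sigma> - (p *\<^sub>R outer u u + (1 - p) *\<^sub>R outer m m - outer \<mu> x
        - outer x \<mu> + outer \<mu> \<mu>))"
    using lp(1) by (simp add: outer_linear algebra_simps w_def)
  moreover have "psd \<dots>" using c lp by (intro psd_scaleR) auto
  ultimately have "psd (l *\<^sub>R (\<gamma>2 *\<^sub>R \<Sigma> + outer \<mu> \<mu>) - (l - 1) *\<^sub>R outer m m - outer u u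
      - outer w \<mu> - outer \<mu> w)" by simp
  moreover have "(l - 1) *\<^sub>R lo \<le> (l - 1) *\<^sub>R m" "(l - 1) *\<^sub>R m \<le> (l - 1) *\<^sub>R hi"
    using m lp(3) by (auto simp: less_eq_vec_def mult_left_mono)
  moreover have "psd (bordered (l - 1) ((l - 1) *\<^sub>R m) ((l - 1) *\<^sub>R outer m m))"
    "psd (bordered 1 u (outer u u))"
    using psd_bordered_outer[of "l - 1" m] psd_bordered_outer[of 1 u] lp by simp_all
  moreover have "psd ((l - 1) *\<^sub>R outer m m)" "psd (outer u u)"
    using lp by (simp_all add: psd_scaleR psd_outer)
  ultimately show ?L using u lp(4) mean w unfolding U_DY_def by blast
qed

end

section \<open>Conditional means of laws on a box\<close>

lemma bounded_linear_outer_right: "bounded_linear (\<lambda>x. outer c (x::real^'n))"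
  and bounded_linear_outer_left: "bounded_linear (\<lambda>x. outer (x::real^'n) c)"
  and bounded_linear_quadratic_form: "bounded_linear (\<lambda>A. y \<bullet> (A *v (y::real^'n)))"
  unfolding linear_conv_bounded_linear[symmetric]
  by (rule linearI; simp add: outer_linear mv_simps inner_add_right)+

lemma continuous_outer: "continuous_on UNIV (\<lambda>u::real^'n. outer u u)"
  unfolding outer_def by (intro continuous_intros)

locale box_distribution = prob_space Q for Q :: "(real^'d) measure" +
  fixes lo hi :: "real^'d"
  assumes sets_borel: "sets Q = sets borel"
    and box: "measure Q {lo..hi} = 1"
begin

lemma space_UNIV [simp]: "space Q = UNIV"
  using sets_eq_imp_space_eq[OF sets_borel] by simp

lemma box_sets: "{lo..hi} \<in> sets Q"
  by (simp add: sets_borel interval_cbox_cart)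

lemma AE_box: "AE u in Q. u \<in> {lo..hi}"
  using box box_sets by (rule_tac AE_prob_1) simp

lemma box_nonempty: "{lo..hi} \<noteq> {}"
  using box by (metis measure_empty zero_neq_one)

lemma integrable_continuous:
  fixes f :: "real^'d \<Rightarrow> 'b::euclidean_space"
  assumes "continuous_on UNIV f"
  shows "integrable Q f"
proof -
  have "compact (f ` {lo..hi})"
    using assms by (intro compact_continuous_image)
      (auto intro: compact_box continuous_on_subset)
  then obtain b where b: "\<And>u. u \<in> {lo..hi} \<Longrightarrow> norm (f u) \<le> b"
    using compact_imp_bounded by (fastforce simp: bounded_iff)
  have [measurable]: "f \<in> borel_measurable Q"
    using borel_measurable_continuous_onI[OF assms] sets_borel by (simp cong: measurable_cong_sets)
  show ?thesis
    by (rule integrable_const_bound[where B = b]) (use AE_box b in auto)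
qed

lemma integrable_on_borel:
  fixes f :: "real^'d \<Rightarrow> 'b::euclidean_space"
  assumes "continuous_on UNIV f" "B \<in> sets borel"
  shows "integrable Q (\<lambda>u. indicator B u *\<^sub>R f u)"
  using assms by (intro integrable_mult_indicator integrable_continuous) (simp_all add: sets_borel)

lemma integral_split:
  fixes f :: "real^'d \<Rightarrow> 'b::euclidean_space"
  assumes "B \<in> sets borel" "continuous_on UNIV f"
  shows "(\<integral>u. f u \<partial>Q) = (\<integral>u. indicator B u *\<^sub>R f u \<partial>Q) + (\<integral>u. indicator (- B) u *\<^sub>R f u \<partial>Q)"
proof -
  have "- B \<in> sets borel" using assms(1) by auto
  then have "(\<integral>u. indicator B u *\<^sub>R f u + indicator (- B) u *\<^sub>R f u \<partial>Q)
      = (\<integral>u. indicator B u *\<^sub>R f u \<partial>Q) + (\<integral>u. indicator (- B) u *\<^sub>R f u \<partial>Q)"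
    using assms by (intro Bochner_Integration.integral_add integrable_on_borel)
  moreover have "(\<lambda>u. indicator B u *\<^sub>R f u + indicator (- B) u *\<^sub>R f u) = f"
    by (auto simp: fun_eq_iff indicator_def)
  ultimately show ?thesis by simp
qed

lemma outer_moment_centred:
  "(\<integral>u. outer (u - c) (u - c) \<partial>Q) = (\<integral>u. outer u u \<partial>Q) - outer c (\<integral>u. u \<partial>Q)
     - outer (\<integral>u. u \<partial>Q) c + outer c c"
proof -
  note bl = bounded_linear_outer_right[of c] bounded_linear_outer_left[of c]
  have id: "integrable Q (\<lambda>u. u)" by (intro integrable_continuous continuous_intros)
  have sq: "integrable Q (\<lambda>u. outer u u)" by (intro integrable_continuous continuous_outer)
  note int = integrable_bounded_linear[OF bl(1) id] integrable_bounded_linear[OF bl(2) id]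
  have "(\<lambda>u. outer (u - c) (u - c)) = (\<lambda>u. outer u u - outer c u - outer u c + outer c c)"
    by (simp add: outer_linear fun_eq_iff)
  then have "(\<integral>u. outer (u - c) (u - c) \<partial>Q)
     = (\<integral>u. outer u u \<partial>Q) - (\<integral>u. outer c u \<partial>Q) - (\<integral>u. outer u c \<partial>Q) + outer c c"
    using int sq prob_space by simp
  then show ?thesis
    by (simp add: integral_bounded_linear[OF bl(1) id] integral_bounded_linear[OF bl(2) id])
qed

text \<open>The domination of the second moment is Jensen's inequality for \<open>u \<mapsto> (y \<bullet> u)\<^sup>2\<close>. The mean is
  stated as a multiple of the mass, so that a null set \<open>B\<close>, where \<open>z\<close> is arbitrary, is covered.\<close>

lemma conditional_mean:
  assumes B: "B \<in> sets borel"
  obtains z where "z \<in> {lo..hi}" "(\<integral>u. indicator B u *\<^sub>R u \<partial>Q) = measure Q B *\<^sub>R z"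
    "psd ((\<integral>u. indicator B u *\<^sub>R outer u u \<partial>Q) - measure Q B *\<^sub>R outer z z)"
proof (cases "measure Q B = 0")
  case True
  then have "AE u in Q. u \<notin> B"
    using B by (intro AE_not_in) (simp add: null_sets_def emeasure_eq_measure sets_borel)
  then have "(\<integral>u. indicator B u *\<^sub>R u \<partial>Q) = 0" "(\<integral>u. indicator B u *\<^sub>R outer u u \<partial>Q) = 0"
    by (auto intro!: integral_eq_zero_AE)
  moreover obtain z where "z \<in> {lo..hi}" using box_nonempty by blast
  ultimately show ?thesis using True by (intro that[of z]) (simp_all add: psd_zero)
next
  case False
  define p where "p = measure Q B"
  have p: "p > 0" using False by (simp add: p_def zero_less_measure_iff)
  have BQ: "B \<in> sets Q" using B by (simp add: sets_borel)
  have ind: "(\<integral>u. indicator B u * c \<partial>Q) = p * c" for c :: real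
    using BQ by (simp add: p_def)
  have id: "integrable Q (\<lambda>u. indicator B u *\<^sub>R u)"
    using B by (intro integrable_on_borel continuous_intros)
  have sq: "integrable Q (\<lambda>u. indicator B u *\<^sub>R outer u u)"
    using B by (intro integrable_on_borel continuous_outer)
  define z where "z = (1 / p) *\<^sub>R (\<integral>u. indicator B u *\<^sub>R u \<partial>Q)"
  have lin: "(\<integral>u. indicator B u * (y \<bullet> u) \<partial>Q) = p * (y \<bullet> z)" for y
    using integral_bounded_linear[OF bounded_linear_inner_right[of y] id] p by (simp add: z_def)
  have int1: "integrable Q (\<lambda>u. indicator B u * (y \<bullet> u))" for y
    using B integrable_on_borel[of "\<lambda>u. y \<bullet> u" B] by (simp add: continuous_intros)
  have intc: "integrable Q (\<lambda>u. indicator B u * c)" for c :: real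
    using B integrable_on_borel[of "\<lambda>u. c" B] by (simp add: continuous_intros)
  have comp: "(\<integral>u. indicator B u * (u $ i) \<partial>Q) = p * z $ i"
    and intcomp: "integrable Q (\<lambda>u. indicator B u * (u $ i))" for i
    using lin[of "axis i 1"] int1[of "axis i 1"] by (simp_all add: inner_axis')
  have "(\<integral>u. indicator B u * lo $ i \<partial>Q) \<le> (\<integral>u. indicator B u * (u $ i) \<partial>Q)"
    "(\<integral>u. indicator B u * (u $ i) \<partial>Q) \<le> (\<integral>u. indicator B u * hi $ i \<partial>Q)" for i
    by (intro integral_mono_AE intc intcomp eventually_mono[OF AE_box];
        auto simp: less_eq_vec_def indicator_def)+
  then have "p * lo $ i \<le> p * z $ i \<and> p * z $ i \<le> p * hi $ i" for i
    by (simp only: comp ind)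
  then have "z \<in> {lo..hi}" using p by (auto simp: less_eq_vec_def)
  moreover have "(\<integral>u. indicator B u *\<^sub>R u \<partial>Q) = p *\<^sub>R z" using p by (simp add: z_def)
  moreover have "psd ((\<integral>u. indicator B u *\<^sub>R outer u u \<partial>Q) - p *\<^sub>R outer z z)"
    unfolding psd_def
  proof (intro conjI allI)
    have bl: "bounded_linear (transpose :: real^'d^'d \<Rightarrow> real^'d^'d)"
      unfolding linear_conv_bounded_linear[symmetric]
      by (rule linearI) (simp_all add: transpose_add transpose_scaleR)
    show "transpose ((\<integral>u. indicator B u *\<^sub>R outer u u \<partial>Q) - p *\<^sub>R outer z z)
        = (\<integral>u. indicator B u *\<^sub>R outer u u \<partial>Q) - p *\<^sub>R outer z z"
      using integral_bounded_linear[OF bl sq]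
      by (simp add: transpose_diff transpose_scaleR transpose_outer)
    fix y
    have int2: "integrable Q (\<lambda>u. indicator B u * (y \<bullet> u)\<^sup>2)"
      using B integrable_on_borel[of "\<lambda>u. (y \<bullet> u)\<^sup>2" B] by (simp add: continuous_intros)
    have "0 \<le> (\<integral>u. indicator B u * (y \<bullet> u - y \<bullet> z)\<^sup>2 \<partial>Q)"
      by (intro integral_nonneg_AE) simp
    also have "(\<lambda>u. indicator B u * (y \<bullet> u - y \<bullet> z)\<^sup>2) = (\<lambda>u. indicator B u * (y \<bullet> u)\<^sup>2
        - (2 * (y \<bullet> z)) * (indicator B u * (y \<bullet> u)) + indicator B u * (y \<bullet> z)\<^sup>2)"
      by (simp add: fun_eq_iff power2_eq_square algebra_simps)
    also have "(\<integral>u. \<dots> u \<partial>Q) = (\<integral>u. indicator B u * (y \<bullet> u)\<^sup>2 \<partial>Q)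
        - (2 * (y \<bullet> z)) * (p * (y \<bullet> z)) + p * (y \<bullet> z)\<^sup>2"
      using int1[of y] int2 intc[of "(y \<bullet> z)\<^sup>2"] by (simp add: lin ind p_def)
    also have "\<dots> = (\<integral>u. indicator B u * (y \<bullet> u)\<^sup>2 \<partial>Q) - p * (y \<bullet> z)\<^sup>2"
      by (simp add: power2_eq_square)
    also have "(\<integral>u. indicator B u * (y \<bullet> u)\<^sup>2 \<partial>Q)
        = y \<bullet> ((\<integral>u. indicator B u *\<^sub>R outer u u \<partial>Q) *v y)"
      unfolding integral_bounded_linear[OF bounded_linear_quadratic_form sq, symmetric]
      by (simp add: mv_simps inner_commute power2_eq_square mult.assoc)
    finally show "0 \<le> y \<bullet> (((\<integral>u. indicator B u *\<^sub>R outer u u \<partial>Q) - p *\<^sub>R outer z z) *v y)"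
      by (simp add: mv_simps inner_diff_right inner_commute power2_eq_square)
  qed
  ultimately show ?thesis using that p_def by blast
qed

text \<open>If \<open>z\<close> were outside \<open>B\<close>, a linear functional \<open>a\<close> would separate it from \<open>B\<close>, strictly since \<open>B\<close>
  is open. Then \<open>a \<bullet> (u - z)\<close> is positive on \<open>B\<close>, yet its integral over \<open>B\<close> vanishes.\<close>

lemma mean_in_open_convex:
  assumes B: "open B" "convex B" and pos: "0 < measure Q B"
    and z: "(\<integral>u. indicator B u *\<^sub>R u \<partial>Q) = measure Q B *\<^sub>R z"
  shows "z \<in> B"
proof (rule ccontr)
  assume "z \<notin> B"
  have "B \<noteq> {}" using pos by auto
  obtain a b where a: "a \<noteq> 0" and ab: "a \<bullet> z \<le> b" "\<And>y. y \<in> B \<Longrightarrow> b \<le> a \<bullet> y"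
    using separating_hyperplane_sets[of "{z}" B] \<open>z \<notin> B\<close> \<open>B \<noteq> {}\<close> B(2) by auto
  have strict: "0 < a \<bullet> (y - z)" if "y \<in> B" for y
  proof -
    obtain e where e: "e > 0" "ball y e \<subseteq> B" using B(1) \<open>y \<in> B\<close> by (meson openE)
    define y' where "y' = y - (e / (2 * norm a)) *\<^sub>R a"
    have "y' \<in> ball y e" using e a by (simp add: y'_def dist_norm)
    then have "b \<le> a \<bullet> y'" using e ab(2) by blast
    moreover have "a \<bullet> y' < a \<bullet> y" using e a by (simp add: y'_def inner_diff_right)
    ultimately show ?thesis using ab(1) by (simp add: inner_diff_right)
  qed
  have Bb: "B \<in> sets borel" using B(1) by simp
  have int: "integrable Q (\<lambda>u. indicator B u * (a \<bullet> (u - z)))"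
    using integrable_on_borel[of "\<lambda>u. a \<bullet> (u - z)" B] Bb by (simp add: continuous_intros)
  have "(\<integral>u. indicator B u * (a \<bullet> (u - z)) \<partial>Q)
      = (\<integral>u. a \<bullet> (indicator B u *\<^sub>R u) - indicator B u * (a \<bullet> z) \<partial>Q)"
    by (simp add: inner_diff_right right_diff_distrib)
  also have "\<dots> = a \<bullet> (measure Q B *\<^sub>R z) - measure Q B * (a \<bullet> z)"
    using integrable_on_borel[of "\<lambda>u. u" B] integrable_on_borel[of "\<lambda>u. a \<bullet> z" B]
      integrable_bounded_linear[OF bounded_linear_inner_right[of a], of Q "\<lambda>u. indicator B u *\<^sub>R u"]
      integral_bounded_linear[OF bounded_linear_inner_right[of a], of Q "\<lambda>u. indicator B u *\<^sub>R u"] Bb z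
    by (simp add: continuous_intros sets_borel)
  finally have "(\<integral>u. indicator B u * (a \<bullet> (u - z)) \<partial>Q) = 0" by simp
  moreover have "AE u in Q. 0 \<le> indicator B u * (a \<bullet> (u - z))"
    using strict by (intro AE_I2) (auto simp: indicator_def less_imp_le)
  ultimately have "AE u in Q. indicator B u * (a \<bullet> (u - z)) = 0"
    using integral_nonneg_eq_0_iff_AE[OF int] by simp
  then have "AE u in Q. u \<notin> B"
    by (rule eventually_mono) (use strict in \<open>force simp: indicator_def split: if_splits\<close>)
  then have "measure Q B = 0"
    using Bb by (intro measure_eq_0_null_sets) (simp add: AE_iff_null_sets sets_borel)
  with pos show False by simp
qed

end

section \<open>The guarantee and the worst-case value at risk\<close>

context factored_covariance
begin

lemma in_P_DY_iff:
  "Q \<in> P_DY lo hi \<mu> \<Sigma> \<gamma>1 \<gamma>2 \<longleftrightarrow> box_distribution Q lo hi \<and>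
     admissible_moments (\<integral>u. u \<partial>Q) (\<integral>u. outer u u \<partial>Q)"
proof (cases "box_distribution Q lo hi")
  case True
  then interpret box_distribution Q lo hi .
  show ?thesis
    using True
    by (simp add: P_DY_def admissible_moments_def Mahalanobis_le_iff outer_moment_centred
        sets_borel box prob_space_axioms)
next
  case False
  then show ?thesis
    by (auto simp: P_DY_def box_distribution_def box_distribution_axioms_def)
qed

text \<open>The two conditional means of \<open>Q\<close>, on \<open>B\<close> and on its complement, are the atoms of an
  admissible two-point law with mass \<open>Q(B)\<close> on the first one.\<close>

lemma U_DY_meets_open_convex:
  assumes \<epsilon>: "0 < \<epsilon>" "\<epsilon> < 1" and Q: "Q \<in> P_DY lo hi \<mu> \<Sigma> \<gamma>1 \<gamma>2"
    and B: "open B" "convex B" and large: "\<epsilon> < measure Q B"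
  obtains u where "u \<in> U_DY lo hi \<mu> \<Sigma> C \<gamma>1 \<gamma>2 \<epsilon>" "u \<in> B"
proof -
  interpret box_distribution Q lo hi using Q in_P_DY_iff by blast
  have Bb: "B \<in> sets borel" "- B \<in> sets borel" using B(1) by auto
  define p where "p = measure Q B"
  have p': "measure Q (- B) = 1 - p"
    using prob_compl[of B] Bb by (simp add: p_def sets_borel Compl_eq_Diff_UNIV)
  obtain u where u: "u \<in> {lo..hi}" "(\<integral>u. indicator B u *\<^sub>R u \<partial>Q) = p *\<^sub>R u"
    "psd ((\<integral>u. indicator B u *\<^sub>R outer u u \<partial>Q) - p *\<^sub>R outer u u)"
    using conditional_mean[OF Bb(1)] unfolding p_def by blast
  obtain m where m: "m \<in> {lo..hi}" "(\<integral>u. indicator (- B) u *\<^sub>R u \<partial>Q) = (1 - p) *\<^sub>R m"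
    "psd ((\<integral>u. indicator (- B) u *\<^sub>R outer u u \<partial>Q) - (1 - p) *\<^sub>R outer m m)"
    using conditional_mean[OF Bb(2)] unfolding p' by blast
  have mean: "(\<integral>u. u \<partial>Q) = p *\<^sub>R u + (1 - p) *\<^sub>R m"
    using integral_split[OF Bb(1) continuous_on_id] u m by simp
  have "(\<integral>u. outer u u \<partial>Q) - (p *\<^sub>R outer u u + (1 - p) *\<^sub>R outer m m)
     = ((\<integral>u. indicator B u *\<^sub>R outer u u \<partial>Q) - p *\<^sub>R outer u u)
       + ((\<integral>u. indicator (- B) u *\<^sub>R outer u u \<partial>Q) - (1 - p) *\<^sub>R outer m m)"
    unfolding integral_split[OF Bb(1) continuous_outer] by simp
  also have "psd \<dots>" using u m by (intro psd_add)
  finally have "admissible_two_point p u m"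
    using Q unfolding in_P_DY_iff admissible_two_point_def mean[symmetric]
    by (blast intro: admissible_moments_mono)
  then have "u \<in> U_DY lo hi \<mu> \<Sigma> C \<gamma>1 \<gamma>2 \<epsilon>"
    using u m large p_def by (subst in_U_DY_iff[OF \<epsilon>]) (auto intro!: exI[of _ p])
  moreover have "u \<in> B"
    using mean_in_open_convex[OF B] u large \<epsilon> by (simp add: p_def)
  ultimately show ?thesis using that by blast
qed

text \<open>If \<open>f > 0\<close> had probability greater than \<open>\<epsilon>\<close>, the uncertainty set would meet the open convex
  set \<open>{f > 0}\<close>.\<close>

lemma U_DY_implies_guarantee:
  assumes \<epsilon>: "0 < \<epsilon>" "\<epsilon> < 1" and Q: "Q \<in> P_DY lo hi \<mu> \<Sigma> \<gamma>1 \<gamma>2"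
  shows "implies_guarantee k Q \<epsilon> (U_DY lo hi \<mu> \<Sigma> C \<gamma>1 \<gamma>2 \<epsilon>)"
  unfolding implies_guarantee_def
proof (intro allI impI, rule ccontr)
  interpret box_distribution Q lo hi using Q in_P_DY_iff by blast
  fix x :: "real^'k" and f :: "real^'d \<Rightarrow> real^'k \<Rightarrow> real"
  assume conc: "\<forall>y. concave_on UNIV (\<lambda>u. f u y)"
    and neg: "\<forall>u\<in>U_DY lo hi \<mu> \<Sigma> C \<gamma>1 \<gamma>2 \<epsilon>. f u x \<le> 0"
    and small: "\<not> 1 - \<epsilon> \<le> measure Q {u. f u x \<le> 0}"
  have cv: "convex_on UNIV (\<lambda>u. - f u x)" using conc by (simp add: concave_on_def)
  have "continuous_on UNIV (\<lambda>u. - f u x)" using convex_on_continuous[OF open_UNIV cv] .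
  then have cont: "continuous_on UNIV (\<lambda>u. f u x)"
    using continuous_on_minus by fastforce
  have op: "open {u. 0 < f u x}" using cont by (intro open_Collect_less continuous_intros)
  have co: "convex {u. 0 < f u x}"
  proof (rule convexI)
    fix a b :: "real^'d" and s t :: real
    assume ab: "a \<in> {u. 0 < f u x}" "b \<in> {u. 0 < f u x}" and st: "0 \<le> s" "0 \<le> t" "s + t = 1"
    have "- f (s *\<^sub>R a + t *\<^sub>R b) x \<le> s * (- f a x) + t * (- f b x)"
      using cv st unfolding convex_on_def by blast
    then have "s * f a x + t * f b x \<le> f (s *\<^sub>R a + t *\<^sub>R b) x" by simp
    moreover have "0 < s * f a x + t * f b x"
      using ab st by (cases "s = 0") (auto intro: add_pos_nonneg)
    ultimately show "s *\<^sub>R a + t *\<^sub>R b \<in> {u. 0 < f u x}" by simp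
  qed
  have "{u. 0 < f u x} = space Q - {u. f u x \<le> 0}" by auto
  moreover have "{u. f u x \<le> 0} \<in> sets Q"
    using cont by (simp add: sets_borel closed_Collect_le continuous_intros)
  ultimately have "\<epsilon> < measure Q {u. 0 < f u x}" using small prob_compl by simp
  then obtain u where "u \<in> U_DY lo hi \<mu> \<Sigma> C \<gamma>1 \<gamma>2 \<epsilon>" "u \<in> {u. 0 < f u x}"
    using U_DY_meets_open_convex[OF \<epsilon> Q op co] by blast
  with neg show False by force
qed

lemma VaR_le_support_fun:
  assumes \<epsilon>: "0 < \<epsilon>" "\<epsilon> < 1" and Q: "Q \<in> P_DY lo hi \<mu> \<Sigma> \<gamma>1 \<gamma>2"
  shows "ereal (VaR \<epsilon> Q v) \<le> support_fun v (U_DY lo hi \<mu> \<Sigma> C \<gamma>1 \<gamma>2 \<epsilon>)"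
proof (rule ccontr)
  interpret box_distribution Q lo hi using Q in_P_DY_iff by blast
  assume "\<not> ?thesis"
  then obtain t where t: "support_fun v (U_DY lo hi \<mu> \<Sigma> C \<gamma>1 \<gamma>2 \<epsilon>) < ereal t" "t < VaR \<epsilon> Q v"
    by (metis ereal_dense2 ereal_less_eq(3) less_ereal.simps(1) not_le)
  have "compact ((\<lambda>u. u \<bullet> v) ` {lo..hi})"
    by (intro compact_continuous_image continuous_intros compact_box)
  then obtain b where b: "\<And>u. u \<in> {lo..hi} \<Longrightarrow> \<bar>u \<bullet> v\<bar> \<le> b"
    using compact_imp_bounded by (fastforce simp: bounded_iff)
  \<comment> \<open>The infimum that defines the value at risk is over a set bounded from below, so that every \<open>t\<close>
     less than the infimum lies outside that set.\<close>
  have "bdd_below {t. 1 - \<epsilon> \<le> measure Q {u. u \<bullet> v \<le> t}}"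
  proof (rule bdd_belowI[of _ "- b"])
    fix s assume "s \<in> {t. 1 - \<epsilon> \<le> measure Q {u. u \<bullet> v \<le> t}}"
    then have s: "0 < measure Q {u. u \<bullet> v \<le> s}" using \<epsilon> by simp
    show "- b \<le> s"
    proof (rule ccontr)
      assume "\<not> - b \<le> s"
      then have "AE u in Q. u \<notin> {u. u \<bullet> v \<le> s}"
        by (intro eventually_mono[OF AE_box]) (use b in fastforce)
      moreover have "{u. u \<bullet> v \<le> s} \<in> sets Q"
        by (simp add: sets_borel closed_Collect_le continuous_intros)
      ultimately have "measure Q {u. u \<bullet> v \<le> s} = 0"
        by (intro measure_eq_0_null_sets) (simp add: AE_iff_null_sets)
      with s show False by simp
    qed
  qed
  then have "\<not> 1 - \<epsilon> \<le> measure Q {u. u \<bullet> v \<le> t}"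
    using t(2) cInf_lower[of t "{t. 1 - \<epsilon> \<le> measure Q {u. u \<bullet> v \<le> t}}"]
    unfolding VaR_def by auto
  moreover have "{u. t < v \<bullet> u} = space Q - {u. u \<bullet> v \<le> t}" by (auto simp: inner_commute)
  moreover have "{u. u \<bullet> v \<le> t} \<in> sets Q"
    by (simp add: sets_borel closed_Collect_le continuous_intros)
  ultimately have "\<epsilon> < measure Q {u. t < v \<bullet> u}" using prob_compl by simp
  then obtain u where u: "u \<in> U_DY lo hi \<mu> \<Sigma> C \<gamma>1 \<gamma>2 \<epsilon>" "t < v \<bullet> u"
    using U_DY_meets_open_convex[OF \<epsilon> Q, of "{u. t < v \<bullet> u}"]
    by (auto simp: open_halfspace_gt convex_halfspace_gt)
  then have "ereal (v \<bullet> u) \<le> support_fun v (U_DY lo hi \<mu> \<Sigma> C \<gamma>1 \<gamma>2 \<epsilon>)"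
    unfolding support_fun_def by (intro SUP_upper)
  with t(1) u(2) show False by (metis ereal_less_eq(3) leD le_less_trans less_imp_le)
qed

definition two_point_law :: "real \<Rightarrow> real^'d \<Rightarrow> real^'d \<Rightarrow> (real^'d) measure" where
  "two_point_law p u m = distr (measure_pmf (bernoulli_pmf p)) borel (\<lambda>b. if b then u else m)"

lemma integral_two_point_law:
  fixes f :: "real^'d \<Rightarrow> 'b::euclidean_space"
  assumes "0 \<le> p" "p \<le> 1" "f \<in> borel_measurable borel"
  shows "(\<integral>x. f x \<partial>two_point_law p u m) = p *\<^sub>R f u + (1 - p) *\<^sub>R f m"
  unfolding two_point_law_def using assms
  by (subst integral_distr) (simp_all add: integral_measure_pmf[of UNIV] UNIV_bool)

lemma measure_two_point_law:
  assumes "0 \<le> p" "p \<le> 1" "A \<in> sets borel"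
  shows "measure (two_point_law p u m) A = p * indicator A u + (1 - p) * indicator A m"
proof -
  have "measure (two_point_law p u m) A = (\<integral>x. indicator A x \<partial>two_point_law p u m)"
    using assms by (simp add: two_point_law_def)
  also have "\<dots> = p * indicator A u + (1 - p) * indicator A m"
    using assms by (subst integral_two_point_law) auto
  finally show ?thesis .
qed

lemma two_point_law_in_P_DY:
  assumes "0 \<le> p" "p \<le> 1" "u \<in> {lo..hi}" "m \<in> {lo..hi}" "admissible_two_point p u m"
  shows "two_point_law p u m \<in> P_DY lo hi \<mu> \<Sigma> \<gamma>1 \<gamma>2"
  unfolding in_P_DY_iff
proof
  have "prob_space (two_point_law p u m)"
    unfolding two_point_law_def by (intro measure_pmf.prob_space_distr) simp
  moreover have "measure (two_point_law p u m) {lo..hi} = 1"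
    using assms by (subst measure_two_point_law) (auto simp: interval_cbox_cart)
  ultimately show "box_distribution (two_point_law p u m) lo hi"
    by (simp add: box_distribution_def box_distribution_axioms_def two_point_law_def)
  show "admissible_moments (\<integral>x. x \<partial>two_point_law p u m) (\<integral>x. outer x x \<partial>two_point_law p u m)"
    using assms integral_two_point_law[OF assms(1,2) borel_measurable_continuous_onI[OF continuous_outer]]
    by (simp add: integral_two_point_law admissible_two_point_def)
qed

text \<open>For \<open>t < v \<bullet> u\<close> the event \<open>x \<bullet> v \<le> t\<close> misses the atom \<open>u\<close> and so has mass at most
  \<open>1 - p < 1 - \<epsilon>\<close>. The strict inequality \<open>\<epsilon> < p\<close> is essential: for \<open>p = \<epsilon>\<close> the other atom may
  already carry the required mass.\<close>

lemma le_VaR_two_point_law: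
  assumes "0 < \<epsilon>" "\<epsilon> < p" "p \<le> 1"
  shows "v \<bullet> u \<le> VaR \<epsilon> (two_point_law p u m) v"
  unfolding VaR_def
proof (rule cInf_greatest)
  have mv: "measure (two_point_law p u m) {x. x \<bullet> v \<le> t}
      = p * indicator {x. x \<bullet> v \<le> t} u + (1 - p) * indicator {x. x \<bullet> v \<le> t} m" for t
    using assms by (intro measure_two_point_law) (auto simp: closed_Collect_le continuous_intros)
  show "{t. 1 - \<epsilon> \<le> measure (two_point_law p u m) {x. x \<bullet> v \<le> t}} \<noteq> {}"
    using assms by (auto simp: mv intro!: exI[of _ "max (u \<bullet> v) (m \<bullet> v)"])
  fix t assume "t \<in> {t. 1 - \<epsilon> \<le> measure (two_point_law p u m) {x. x \<bullet> v \<le> t}}"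
  then show "v \<bullet> u \<le> t"
    using assms by (cases "u \<bullet> v \<le> t"; cases "m \<bullet> v \<le> t") (simp_all add: mv inner_commute)
qed

text \<open>Raising the mass at the first atom from \<open>p\<close> to \<open>q\<close> while moving it towards \<open>m\<close> by the factor
  \<open>p / q\<close> keeps the mean and decreases the second moment by \<open>p (1 - p / q)\<close> times the outer square of
  \<open>u - m\<close>.\<close>

lemma admissible_two_point_shrink:
  assumes "admissible_two_point p u m" "0 < p" "p \<le> q" "q \<le> 1"
  shows "admissible_two_point q (m + (p / q) *\<^sub>R (u - m)) m"
proof -
  define d where "d = u - m"
  have u: "u = m + d" by (simp add: d_def)
  have q: "q > 0" using assms by simp
  have mean: "q *\<^sub>R (m + (p / q) *\<^sub>R d) + (1 - q) *\<^sub>R m = p *\<^sub>R u + (1 - p) *\<^sub>R m"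
    using q by (simp add: u algebra_simps)
  have "(p *\<^sub>R outer u u + (1 - p) *\<^sub>R outer m m)
      - (q *\<^sub>R outer (m + (p / q) *\<^sub>R d) (m + (p / q) *\<^sub>R d) + (1 - q) *\<^sub>R outer m m)
      = (p * (1 - p / q)) *\<^sub>R outer d d"
    using q by (simp add: u outer_linear algebra_simps)
  also have "psd \<dots>" using assms q by (intro psd_scaleR psd_outer) (simp add: field_simps)
  finally show ?thesis
    using assms(1) unfolding admissible_two_point_def d_def[symmetric] mean
    by (rule admissible_moments_mono[rotated])
qed

text \<open>Points of the uncertainty set with mass exactly \<open>\<epsilon>\<close> are reached as limits of shrunken ones, whose
  mass exceeds \<open>\<epsilon>\<close>.\<close>

lemma support_fun_le_VaR:
  assumes \<epsilon>: "0 < \<epsilon>" "\<epsilon> < 1"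
  shows "support_fun v (U_DY lo hi \<mu> \<Sigma> C \<gamma>1 \<gamma>2 \<epsilon>)
     \<le> (SUP Q \<in> P_DY lo hi \<mu> \<Sigma> \<gamma>1 \<gamma>2. ereal (VaR \<epsilon> Q v))" (is "_ \<le> ?S")
  unfolding support_fun_def
proof (rule SUP_least)
  fix u assume "u \<in> U_DY lo hi \<mu> \<Sigma> C \<gamma>1 \<gamma>2 \<epsilon>"
  then obtain p m where u: "u \<in> {lo..hi}" and p: "\<epsilon> \<le> p" "p \<le> 1" and m: "m \<in> {lo..hi}"
    and tp: "admissible_two_point p u m"
    unfolding in_U_DY_iff[OF \<epsilon>] by blast
  \<comment> \<open>For \<open>0 < \<tau> < 1\<close> this mass exceeds \<open>\<epsilon>\<close>: it is larger than \<open>p\<close>, or else \<open>p = 1\<close>.\<close>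
  define q where "q \<tau> = p + \<tau> * (1 - p)" for \<tau>
  have *: "ereal (v \<bullet> (m + (p / q \<tau>) *\<^sub>R (u - m))) \<le> ?S" if \<tau>: "0 < \<tau>" "\<tau> < 1" for \<tau>
  proof -
    have "0 < \<tau> * (1 - p) \<or> p = 1" using \<tau> p by (cases "p = 1") simp_all
    then have q: "p \<le> q \<tau>" "\<epsilon> < q \<tau>" "q \<tau> \<le> 1"
      using p \<epsilon> \<tau> mult_left_le_one_le[of "1 - p" \<tau>] unfolding q_def by auto
    define u' where "u' = m + (p / q \<tau>) *\<^sub>R (u - m)"
    have "u' = (1 - p / q \<tau>) *\<^sub>R m + (p / q \<tau>) *\<^sub>R u" by (simp add: u'_def algebra_simps)
    then have "u' \<in> {lo..hi}"
      using u m q p \<epsilon> by (simp only:) (rule convexD[OF convex_box]; simp)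
    moreover have "admissible_two_point (q \<tau>) u' m"
      unfolding u'_def using tp p q \<epsilon> by (intro admissible_two_point_shrink) auto
    ultimately have "two_point_law (q \<tau>) u' m \<in> P_DY lo hi \<mu> \<Sigma> \<gamma>1 \<gamma>2"
      using m q \<epsilon> by (intro two_point_law_in_P_DY) auto
    moreover have "v \<bullet> u' \<le> VaR \<epsilon> (two_point_law (q \<tau>) u' m) v"
      using q \<epsilon> by (intro le_VaR_two_point_law) auto
    ultimately show ?thesis unfolding u'_def[symmetric]
      by (meson SUP_upper2 ereal_less_eq(3))
  qed
  have "((\<lambda>\<tau>. v \<bullet> (m + (p / q \<tau>) *\<^sub>R (u - m))) \<longlongrightarrow> v \<bullet> (m + (p / (p + 0 * (1 - p))) *\<^sub>R (u - m)))
      (at_right 0)"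
    unfolding q_def using p \<epsilon> by (intro tendsto_intros) auto
  then have "((\<lambda>\<tau>. ereal (v \<bullet> (m + (p / q \<tau>) *\<^sub>R (u - m)))) \<longlongrightarrow> ereal (v \<bullet> u)) (at_right 0)"
    using p \<epsilon> by simp
  moreover have "\<forall>\<^sub>F \<tau> in at_right 0. ereal (v \<bullet> (m + (p / q \<tau>) *\<^sub>R (u - m))) \<le> ?S"
    using * by (auto simp: eventually_at_right_field intro!: exI[of _ 1])
  ultimately show "ereal (v \<bullet> u) \<le> ?S"
    by (rule tendsto_upperbound) simp
qed

end

section \<open>Convex quadratics that are nonnegative on a box\<close>

text \<open>Dehomogenization: for \<open>c \<noteq> 0\<close> scale by \<open>c\<^sup>2\<close>, and for \<open>c = 0\<close> only the quadratic part is
  left.\<close>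

lemma psd_borderedI:
  assumes Z: "psd Z" and nonneg: "\<And>x. 0 \<le> a + 2 * (b \<bullet> x) + x \<bullet> (Z *v x)"
  shows "psd (bordered a b Z)"
  unfolding psd_bordered_iff
proof (intro conjI allI)
  show "transpose Z = Z" using Z by (simp add: psd_def)
  fix c x
  show "0 \<le> a * c\<^sup>2 + 2 * c * (b \<bullet> x) + x \<bullet> (Z *v x)"
  proof (cases "c = 0")
    case True
    then show ?thesis using Z by (simp add: psd_def)
  next
    case False
    have "0 \<le> c\<^sup>2 * (a + 2 * (b \<bullet> ((1 / c) *\<^sub>R x)) + ((1 / c) *\<^sub>R x) \<bullet> (Z *v ((1 / c) *\<^sub>R x)))"
      by (rule mult_nonneg_nonneg[OF zero_le_power2 nonneg])
    also have "\<dots> = a * c\<^sup>2 + 2 * c * (b \<bullet> x) + x \<bullet> (Z *v x)"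
      using False by (simp add: matrix_vector_mult_scaleR power2_eq_square field_simps)
    finally show ?thesis .
  qed
qed

lemma inner_nonneg_vec: "0 \<le> x \<Longrightarrow> 0 \<le> y \<Longrightarrow> 0 \<le> x \<bullet> (y::real^'n)"
  by (auto simp: inner_vec_def less_eq_vec_def intro!: sum_nonneg mult_nonneg_nonneg)

lemma nonneg_on_box_of_bordered:
  assumes "psd (bordered (c + yp \<bullet> lo - ym \<bullet> hi) ((1/2) *\<^sub>R (b - (yp - ym))) Z)"
    and "0 \<le> yp" "0 \<le> ym" "u \<in> {lo..hi}"
  shows "0 \<le> c + b \<bullet> u + u \<bullet> (Z *v u)"
proof -
  have "0 \<le> c + yp \<bullet> lo - ym \<bullet> hi + (b - (yp - ym)) \<bullet> u + u \<bullet> (Z *v u)"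
    using assms(1)[unfolded psd_bordered_iff, THEN conjunct2, rule_format, of 1 u] by simp
  moreover have "0 \<le> yp \<bullet> (u - lo)" "0 \<le> ym \<bullet> (hi - u)"
    using assms by (auto intro!: inner_nonneg_vec)
  ultimately show ?thesis by (simp add: algebra_simps inner_diff_left inner_diff_right)
qed

text \<open>The multipliers are the positive and negative parts of the gradient \<open>h\<close> at a minimizer \<open>s\<close> on
  the box. The vertex \<open>w\<close> that minimizes \<open>h \<bullet> w\<close> realizes \<open>yp \<bullet> lo - ym \<bullet> hi\<close>, and the quadratic
  lies above its tangent at \<open>s\<close>. On an empty box the hypothesis is void: there multipliers cancel the
  linear term, and a coordinate with \<open>hi $ i < lo $ i\<close> lifts the constant as far as needed.\<close>

lemma box_multipliers:
  fixes Z :: "real^'n^'n"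
  assumes Z: "psd Z" and nonneg: "\<And>u. u \<in> {lo..hi} \<Longrightarrow> 0 \<le> c + b \<bullet> u + u \<bullet> (Z *v u)"
  obtains yp ym where "0 \<le> yp" "0 \<le> ym"
    "psd (bordered (c + yp \<bullet> lo - ym \<bullet> hi) ((1/2) *\<^sub>R (b - (yp - ym))) Z)"
proof (cases "{lo..hi} = {}")
  case True
  then obtain i where i: "hi $ i < lo $ i" by (auto simp: less_eq_vec_def not_le)
  define bp bm where "bp = (\<chi> j. max (b $ j) 0)" and "bm = (\<chi> j. max (- b $ j) 0)"
  have bb: "b = bp - bm" "0 \<le> bp" "0 \<le> bm"
    by (auto simp: bp_def bm_def vec_eq_iff less_eq_vec_def)
  define e where "e = c + bp \<bullet> lo - bm \<bullet> hi"
  define k where "k = \<bar>e\<bar> / (lo $ i - hi $ i)"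
  have "k * (lo $ i - hi $ i) = \<bar>e\<bar>" using i by (simp add: k_def)
  then have k: "0 \<le> k" "k * lo $ i - k * hi $ i = \<bar>e\<bar>"
    using i by (simp_all add: k_def right_diff_distrib)
  show ?thesis
  proof (rule that[of "bp + k *\<^sub>R axis i 1" "bm + k *\<^sub>R axis i 1"])
    show "0 \<le> bp + k *\<^sub>R axis i 1" "0 \<le> bm + k *\<^sub>R axis i 1"
      using bb k by (auto simp: less_eq_vec_def axis_def)
    have "c + (bp + k *\<^sub>R axis i 1) \<bullet> lo - (bm + k *\<^sub>R axis i 1) \<bullet> hi = e + \<bar>e\<bar>"
      using k(2) by (simp add: e_def inner_add_left inner_axis')
    moreover have "0 \<le> e + \<bar>e\<bar>" by simp
    ultimately show "psd (bordered (c + (bp + k *\<^sub>R axis i 1) \<bullet> lo - (bm + k *\<^sub>R axis i 1) \<bullet> hi)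
        ((1/2) *\<^sub>R (b - (bp + k *\<^sub>R axis i 1 - (bm + k *\<^sub>R axis i 1)))) Z)"
      using Z bb(1) by (intro psd_borderedI) (simp_all add: psd_def)
  qed
next
  case False
  have sym: "transpose Z = Z" using Z by (simp add: psd_def)
  define g where "g u = c + b \<bullet> u + u \<bullet> (Z *v u)" for u
  have "continuous_on {lo..hi} g"
    unfolding g_def
    by (intro continuous_intros linear_continuous_on linear_conv_bounded_linear[THEN iffD1]
        matrix_vector_mul_linear)
  then obtain s where s: "s \<in> {lo..hi}" and min: "\<And>u. u \<in> {lo..hi} \<Longrightarrow> g s \<le> g u"
    using continuous_attains_inf[OF compact_box, of lo hi g] False by auto
  define h where "h = b + 2 *\<^sub>R (Z *v s)"
  have expand: "g (s + d) = g s + h \<bullet> d + d \<bullet> (Z *v d)" for d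
    unfolding g_def quadratic_form_add[OF sym]
    by (simp add: h_def inner_add_left inner_add_right inner_commute)
  have first_order: "h \<bullet> s \<le> h \<bullet> w" if w: "w \<in> {lo..hi}" for w
  proof (rule ccontr)
    assume "\<not> h \<bullet> s \<le> h \<bullet> w"
    then have neg: "h \<bullet> (w - s) < 0" by (simp add: inner_diff_right)
    define e where "e = (w - s) \<bullet> (Z *v (w - s))"
    have e: "0 \<le> e" using Z by (simp add: e_def psd_def)
    \<comment> \<open>A step so short that the linear decrease outweighs the quadratic term \<open>\<tau>\<^sup>2 e\<close>.\<close>
    define \<tau> where "\<tau> = min 1 (- (h \<bullet> (w - s)) / (e + 1))"
    have \<tau>: "0 < \<tau>" "\<tau> \<le> 1" using neg e by (auto simp: \<tau>_def divide_neg_pos)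
    have "\<tau> * (e + 1) \<le> (- (h \<bullet> (w - s)) / (e + 1)) * (e + 1)"
      using e by (intro mult_right_mono) (auto simp: \<tau>_def)
    also have "\<dots> = - (h \<bullet> (w - s))" using e by simp
    finally have "\<tau> * e < - (h \<bullet> (w - s))" using \<tau> by (simp add: distrib_left)
    then have "\<tau> * (h \<bullet> (w - s) + \<tau> * e) < 0" using \<tau> by (intro mult_pos_neg) auto
    moreover have "s + \<tau> *\<^sub>R (w - s) \<in> {lo..hi}"
    proof -
      have "(1 - \<tau>) *\<^sub>R s + \<tau> *\<^sub>R w \<in> {lo..hi}"
        using s w \<tau> convexD[OF convex_box, of s lo hi w "1 - \<tau>" \<tau>] by simp
      then show ?thesis by (simp add: algebra_simps)
    qed
    then have "g s \<le> g (s + \<tau> *\<^sub>R (w - s))" by (rule min)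
    moreover have "g (s + \<tau> *\<^sub>R (w - s)) = g s + \<tau> * (h \<bullet> (w - s) + \<tau> * e)"
      unfolding expand by (simp add: matrix_vector_mult_scaleR e_def distrib_left)
    ultimately show False by linarith
  qed
  define yp ym w where "yp = (\<chi> j. max (h $ j) 0)" and "ym = (\<chi> j. max (- h $ j) 0)"
    and "w = (\<chi> j. if 0 < h $ j then lo $ j else hi $ j)"
  have y: "h = yp - ym" "0 \<le> yp" "0 \<le> ym"
    by (auto simp: yp_def ym_def vec_eq_iff less_eq_vec_def)
  have "w \<in> {lo..hi}" using s by (auto simp: w_def less_eq_vec_def intro: order_trans)
  have hw: "h \<bullet> w = yp \<bullet> lo - ym \<bullet> hi"
    unfolding inner_vec_def sum_subtractf[symmetric]
    by (rule sum.cong) (auto simp: yp_def ym_def w_def)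
  show ?thesis
  proof (rule that[OF y(2,3)], rule psd_borderedI[OF Z])
    fix u
    have "0 \<le> g s" using nonneg[OF s] by (simp add: g_def)
    moreover have "g u = g s + h \<bullet> (u - s) + (u - s) \<bullet> (Z *v (u - s))"
      using expand[of "u - s"] by simp
    moreover have "0 \<le> (u - s) \<bullet> (Z *v (u - s))" using Z by (simp add: psd_def)
    moreover have "h \<bullet> s \<le> h \<bullet> w" using first_order[OF \<open>w \<in> {lo..hi}\<close>] .
    ultimately have "0 \<le> g u + h \<bullet> w - h \<bullet> u" by (simp add: inner_diff_right)
    then show "0 \<le> c + yp \<bullet> lo - ym \<bullet> hi + 2 * (((1/2) *\<^sub>R (b - (yp - ym))) \<bullet> u) + u \<bullet> (Z *v u)"
      unfolding hw y(1)[symmetric] by (simp add: g_def inner_diff_left algebra_simps)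
  qed
qed

section \<open>Convex sets of moments\<close>

lemma nonneg_of_ray_bounded_below:
  fixes a b c :: real
  assumes "\<And>k. 0 \<le> k \<Longrightarrow> b < c + k * a"
  shows "0 \<le> a"
proof (rule ccontr)
  assume a: "\<not> 0 \<le> a"
  have "0 \<le> \<bar>c - b\<bar> / - a" using a by (intro divide_nonneg_pos) auto
  then have "b < c + \<bar>c - b\<bar> / - a * a" by (rule assms)
  also have "\<dots> = c - \<bar>c - b\<bar>" using a by simp
  finally show False by simp
qed

lemma transpose_inner: "transpose A \<bullet> B = A \<bullet> transpose (B::real^'n^'n)"
  unfolding inner_vec_def transpose_def by (simp add: sum.swap[of "\<lambda>i j. A $ j $ i * B $ i $ j"])

lemma closed_psd: "closed {A. psd A}"
proof -
  have "linear (transpose :: real^'a^'a \<Rightarrow> real^'a^'a)"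
    by (rule linearI) (simp_all add: transpose_add transpose_scaleR)
  then have tr: "continuous_on UNIV (transpose :: real^'a^'a \<Rightarrow> real^'a^'a)"
    by (simp add: linear_continuous_on linear_conv_bounded_linear)
  have "continuous_on UNIV (\<lambda>A. x \<bullet> (A *v x))" for x :: "real^'a"
    by (intro linear_continuous_on bounded_linear_quadratic_form)
  then show ?thesis unfolding psd_def
    by (intro closed_Collect_conj closed_Collect_all closed_Collect_eq closed_Collect_le tr
        continuous_on_id continuous_on_const)
qed

text \<open>The defect of \<open>m \<mapsto> outer m m\<close> from being affine is the outer square of \<open>m - n\<close>, which is positive
  semidefinite. This is the convex superset into which the moments of laws on the box are enclosed.\<close>

lemma convex_dominated_moments:
  "convex {(m, A) |m A. m \<in> {lo..hi::real^'n} \<and> psd (A - outer m m)}"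
proof (rule convexI)
  fix a b :: "(real^'n) \<times> (real^'n^'n)" and s t :: real
  assume "a \<in> {(m, A) |m A. m \<in> {lo..hi} \<and> psd (A - outer m m)}"
    "b \<in> {(m, A) |m A. m \<in> {lo..hi} \<and> psd (A - outer m m)}" and st: "0 \<le> s" "0 \<le> t" "s + t = 1"
  then obtain m A n B where a: "a = (m, A)" and b: "b = (n, B)" and mn: "m \<in> {lo..hi}" "n \<in> {lo..hi}"
    and AB: "psd (A - outer m m)" "psd (B - outer n n)" by auto
  have "s *\<^sub>R m + t *\<^sub>R n \<in> {lo..hi}"
    using mn st convexD[OF convex_box, of m lo hi n s t] by simp
  moreover have t: "t = 1 - s" using st by simp
  have "s *\<^sub>R A + t *\<^sub>R B - outer (s *\<^sub>R m + t *\<^sub>R n) (s *\<^sub>R m + t *\<^sub>R n)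
      = s *\<^sub>R (A - outer m m) + t *\<^sub>R (B - outer n n) + (s * t) *\<^sub>R outer (m - n) (m - n)"
    by (simp add: t outer_linear algebra_simps)
  moreover have "psd \<dots>" using AB st by (intro psd_add psd_scaleR psd_outer) auto
  ultimately show "s *\<^sub>R a + t *\<^sub>R b \<in> {(m, A) |m A. m \<in> {lo..hi} \<and> psd (A - outer m m)}"
    by (simp add: a b)
qed

section \<open>Duality\<close>

context factored_covariance
begin

text \<open>The maximum of \<open>A \<bullet> Z + q \<bullet> x\<close> over the admissible moments \<open>(x, A)\<close>, for \<open>Z\<close> positive
  semidefinite (\<open>admissible_le_worst_case_moment\<close>, \<open>worst_case_moment_attained\<close>).\<close>

definition worst_case_moment :: "real^'d \<Rightarrow> real^'d^'d \<Rightarrow> real" where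
  "worst_case_moment q Z = frob (\<gamma>2 *\<^sub>R \<Sigma> + outer \<mu> \<mu>) Z + \<mu> \<bullet> q
     + sqrt \<gamma>1 * wnorm \<Sigma> (q + 2 *\<^sub>R (Z *v \<mu>))"

text \<open>For a given mean \<open>x\<close> the matrix on the left is the largest admissible second moment.\<close>

lemma worst_case_moment_expand:
  assumes "transpose Z = Z"
  shows "(\<gamma>2 *\<^sub>R \<Sigma> + outer \<mu> x + outer x \<mu> - outer \<mu> \<mu>) \<bullet> Z + q \<bullet> x
     = frob (\<gamma>2 *\<^sub>R \<Sigma> + outer \<mu> \<mu>) Z + \<mu> \<bullet> q + (q + 2 *\<^sub>R (Z *v \<mu>)) \<bullet> (x - \<mu>)"
  using symmetric_mv[OF assms, of \<mu> x]
  by (simp add: frob_eq_inner outer_inner inner_add_left inner_diff_left inner_diff_right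
      inner_commute[of "Z *v \<mu>"] inner_commute[of q] algebra_simps)

lemma admissible_le_worst_case_moment:
  assumes adm: "admissible_moments x A" and Z: "psd Z"
  shows "A \<bullet> Z + q \<bullet> x \<le> worst_case_moment q Z"
proof -
  have sym: "transpose Z = Z" using Z by (simp add: psd_def)
  have "0 \<le> (\<gamma>2 *\<^sub>R \<Sigma> - (A - outer \<mu> x - outer x \<mu> + outer \<mu> \<mu>)) \<bullet> Z"
    using adm Z by (intro psd_inner_psd_nonneg) (simp_all add: admissible_moments_def)
  then have "A \<bullet> Z + q \<bullet> x \<le> (\<gamma>2 *\<^sub>R \<Sigma> + outer \<mu> x + outer x \<mu> - outer \<mu> \<mu>) \<bullet> Z + q \<bullet> x"
    by (simp add: inner_diff_left inner_add_left)
  also have "\<dots> \<le> worst_case_moment q Z"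
    unfolding worst_case_moment_expand[OF sym] worst_case_moment_def
    using adm by (simp add: admissible_moments_def ellipsoid_support_le)
  finally show ?thesis .
qed

lemma worst_case_moment_attained:
  assumes "transpose Z = Z"
  obtains x A where "admissible_moments x A" "transpose A = A" "A \<bullet> Z + q \<bullet> x = worst_case_moment q Z"
proof -
  obtain d where d: "norm (C *v d) \<le> sqrt \<gamma>1"
    "(q + 2 *\<^sub>R (Z *v \<mu>)) \<bullet> d = sqrt \<gamma>1 * wnorm \<Sigma> (q + 2 *\<^sub>R (Z *v \<mu>))"
    by (rule ellipsoid_support_attained)
  show ?thesis
  proof (rule that[of "\<mu> + d" "\<gamma>2 *\<^sub>R \<Sigma> + outer \<mu> (\<mu> + d) + outer (\<mu> + d) \<mu> - outer \<mu> \<mu>"])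
    show "admissible_moments (\<mu> + d) (\<gamma>2 *\<^sub>R \<Sigma> + outer \<mu> (\<mu> + d) + outer (\<mu> + d) \<mu> - outer \<mu> \<mu>)"
      using d(1) by (simp add: admissible_moments_def psd_def transpose_def vec_eq_iff)
  qed (use worst_case_moment_expand[OF assms, of "\<mu> + d" q] d(2) in
      \<open>simp_all add: worst_case_moment_def transpose_add transpose_diff transpose_scaleR
        transpose_outer symmetric_cov\<close>)
qed

lemma worst_case_moment_scale:
  "0 \<le> k \<Longrightarrow> worst_case_moment (k *\<^sub>R q) (k *\<^sub>R Z) = k * worst_case_moment q Z"
proof -
  assume k: "0 \<le> k"
  have "wnorm \<Sigma> (k *\<^sub>R x) = k * wnorm \<Sigma> x" for x
    using k by (simp add: norm_factor_cov[symmetric] matrix_vector_mult_scaleR)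
  moreover have "k *\<^sub>R q + 2 *\<^sub>R ((k *\<^sub>R Z) *v \<mu>) = k *\<^sub>R (q + 2 *\<^sub>R (Z *v \<mu>))"
    by (simp add: scaleR_mv scaleR_add_right)
  ultimately have "wnorm \<Sigma> (k *\<^sub>R q + 2 *\<^sub>R ((k *\<^sub>R Z) *v \<mu>)) = k * wnorm \<Sigma> (q + 2 *\<^sub>R (Z *v \<mu>))"
    by (simp only:)
  then show ?thesis
    unfolding worst_case_moment_def by (simp only:) (simp add: frob_eq_inner algebra_simps)
qed

text \<open>The semidefinite constraints say that the quadratic \<open>g(u) = r + q \<bullet> u + u \<bullet> Z u\<close> satisfies
  \<open>g \<ge> 0\<close> and \<open>g(u) \<ge> \<theta> + v \<bullet> u - t\<close> on the box, and \<open>s\<close> is best chosen minimal.\<close>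

lemma in_dual_DY_iff:
  "t \<in> dual_DY lo hi \<mu> \<Sigma> \<gamma>1 \<gamma>2 \<epsilon> v \<longleftrightarrow> (\<exists>r \<theta> q Z. psd Z \<and> 0 \<le> \<theta> \<and>
     r + worst_case_moment q Z \<le> \<theta> * \<epsilon> \<and>
     (\<forall>u\<in>{lo..hi}. 0 \<le> r + q \<bullet> u + u \<bullet> (Z *v u)) \<and>
     (\<forall>u\<in>{lo..hi}. \<theta> + (v \<bullet> u - t) \<le> r + q \<bullet> u + u \<bullet> (Z *v u)))" (is "?L \<longleftrightarrow> ?R")
proof
  assume ?L
  then obtain r s \<theta> q y1p y1m y2p y2m Z where sym: "transpose Z = Z"
    and rs: "r + s \<le> \<theta> * \<epsilon>" and s: "worst_case_moment q Z \<le> s" and \<theta>: "0 \<le> \<theta>"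
    and b1: "psd (bordered (r + y1p \<bullet> lo - y1m \<bullet> hi) ((1/2) *\<^sub>R (q - (y1p - y1m))) Z)"
    and b2: "psd (bordered (r + y2p \<bullet> lo - y2m \<bullet> hi + t - \<theta>) ((1/2) *\<^sub>R (q - (y2p - y2m) - v)) Z)"
    and y: "0 \<le> y1p" "0 \<le> y1m" "0 \<le> y2p" "0 \<le> y2m"
    unfolding dual_DY_def worst_case_moment_def by blast
  have "psd Z" unfolding psd_def
  proof (intro conjI allI sym)
    fix x show "0 \<le> x \<bullet> (Z *v x)"
      using b1[unfolded psd_bordered_iff, THEN conjunct2, rule_format, of 0 x] by simp
  qed
  moreover have "psd (bordered ((r + t - \<theta>) + y2p \<bullet> lo - y2m \<bullet> hi)
      ((1/2) *\<^sub>R ((q - v) - (y2p - y2m))) Z)"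
    using b2 by (simp add: algebra_simps)
  then have "\<forall>u\<in>{lo..hi}. 0 \<le> (r + t - \<theta>) + (q - v) \<bullet> u + u \<bullet> (Z *v u)"
    using y by (blast intro: nonneg_on_box_of_bordered)
  then have "\<forall>u\<in>{lo..hi}. \<theta> + (v \<bullet> u - t) \<le> r + q \<bullet> u + u \<bullet> (Z *v u)"
    by (simp add: inner_diff_left algebra_simps)
  moreover have "\<forall>u\<in>{lo..hi}. 0 \<le> r + q \<bullet> u + u \<bullet> (Z *v u)"
    using b1 y by (blast intro: nonneg_on_box_of_bordered)
  moreover have "r + worst_case_moment q Z \<le> \<theta> * \<epsilon>" using rs s by simp
  ultimately show ?R using \<theta> by blast
next
  assume ?R
  then obtain r \<theta> q Z where Z: "psd Z" and \<theta>: "0 \<le> \<theta>"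
    and rs: "r + worst_case_moment q Z \<le> \<theta> * \<epsilon>"
    and g1: "\<And>u. u \<in> {lo..hi} \<Longrightarrow> 0 \<le> r + q \<bullet> u + u \<bullet> (Z *v u)"
    and g2: "\<And>u. u \<in> {lo..hi} \<Longrightarrow> \<theta> + (v \<bullet> u - t) \<le> r + q \<bullet> u + u \<bullet> (Z *v u)" by blast
  obtain y1p y1m where y1: "0 \<le> y1p" "0 \<le> y1m"
    "psd (bordered (r + y1p \<bullet> lo - y1m \<bullet> hi) ((1/2) *\<^sub>R (q - (y1p - y1m))) Z)"
    using box_multipliers[OF Z g1] .
  have "0 \<le> (r + t - \<theta>) + (q - v) \<bullet> u + u \<bullet> (Z *v u)" if "u \<in> {lo..hi}" for u
    using g2[OF that] by (simp add: inner_diff_left)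
  then obtain y2p y2m where y2: "0 \<le> y2p" "0 \<le> y2m"
    "psd (bordered ((r + t - \<theta>) + y2p \<bullet> lo - y2m \<bullet> hi) ((1/2) *\<^sub>R ((q - v) - (y2p - y2m))) Z)"
    using box_multipliers[OF Z] by metis
  have b2: "psd (bordered (r + y2p \<bullet> lo - y2m \<bullet> hi + t - \<theta>)
      ((1/2) *\<^sub>R (q - (y2p - y2m) - v)) Z)"
    using y2(3) by (simp add: algebra_simps)
  have sym: "transpose Z = Z" using Z by (simp add: psd_def)
  have s: "frob (\<gamma>2 *\<^sub>R \<Sigma> + outer \<mu> \<mu>) Z + \<mu> \<bullet> q
      + sqrt \<gamma>1 * wnorm \<Sigma> (q + 2 *\<^sub>R (Z *v \<mu>)) \<le> worst_case_moment q Z"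
    by (simp add: worst_case_moment_def)
  show ?L unfolding dual_DY_def mem_Collect_eq
    by (rule exI[of _ r], rule exI[of _ "worst_case_moment q Z"], rule exI[of _ \<theta>],
        rule exI[of _ q], rule exI[of _ "y1p - y1m"], rule exI[of _ y1p],
        rule exI[of _ y1m], rule exI[of _ "y2p - y2m"], rule exI[of _ y2p],
        rule exI[of _ y2m], rule exI[of _ Z], intro conjI)
       (fact sym rs y1 y2 b2 s \<theta> | rule refl)+
qed

text \<open>Integrating \<open>g\<close> against the two-point law of \<open>u\<close> gives
  \<open>p g(u) \<le> p g(u) + (1 - p) g(m) \<le> \<theta> \<epsilon> \<le> \<theta> p\<close>, so \<open>g(u) \<le> \<theta>\<close>.\<close>

lemma weak_duality:
  assumes \<epsilon>: "0 < \<epsilon>" "\<epsilon> < 1" and u: "u \<in> U_DY lo hi \<mu> \<Sigma> C \<gamma>1 \<gamma>2 \<epsilon>"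
    and t: "t \<in> dual_DY lo hi \<mu> \<Sigma> \<gamma>1 \<gamma>2 \<epsilon> v"
  shows "v \<bullet> u \<le> t"
proof -
  obtain p m where "u \<in> {lo..hi}" and p: "\<epsilon> \<le> p" "p \<le> 1" and "m \<in> {lo..hi}"
    and tp: "admissible_two_point p u m"
    using u unfolding in_U_DY_iff[OF \<epsilon>] by blast
  obtain r \<theta> q Z where Z: "psd Z" "0 \<le> \<theta>" and rs: "r + worst_case_moment q Z \<le> \<theta> * \<epsilon>"
    and g1: "\<forall>u\<in>{lo..hi}. 0 \<le> r + q \<bullet> u + u \<bullet> (Z *v u)"
    and g2: "\<forall>u\<in>{lo..hi}. \<theta> + (v \<bullet> u - t) \<le> r + q \<bullet> u + u \<bullet> (Z *v u)"
    using t unfolding in_dual_DY_iff by blast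
  define g where "g u = r + q \<bullet> u + u \<bullet> (Z *v u)" for u
  have "p * g u \<le> p * g u + (1 - p) * g m"
    using g1 \<open>m \<in> {lo..hi}\<close> p by (simp add: g_def)
  also have "\<dots> = r + ((p *\<^sub>R outer u u + (1 - p) *\<^sub>R outer m m) \<bullet> Z
      + q \<bullet> (p *\<^sub>R u + (1 - p) *\<^sub>R m))"
    by (simp add: g_def inner_add_left inner_add_right outer_inner algebra_simps)
  also have "\<dots> \<le> r + worst_case_moment q Z"
    using admissible_le_worst_case_moment[OF tp[unfolded admissible_two_point_def] Z(1)] by simp
  also have "\<dots> \<le> \<theta> * \<epsilon>" by (rule rs)
  also have "\<dots> \<le> p * \<theta>" using mult_left_mono[OF p(1) Z(2)] by (simp add: mult.commute)
  finally have "g u \<le> \<theta>" using p \<epsilon> by simp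
  moreover have "\<theta> + (v \<bullet> u - t) \<le> g u" using g2 \<open>u \<in> {lo..hi}\<close> by (simp add: g_def)
  ultimately show ?thesis by simp
qed

lemma convex_admissible: "convex {(x, A). admissible_moments x A}"
proof (rule convexI)
  fix a b :: "(real^'d) \<times> (real^'d^'d)" and s t :: real
  assume "a \<in> {(x, A). admissible_moments x A}" "b \<in> {(x, A). admissible_moments x A}"
    and st: "0 \<le> s" "0 \<le> t" "s + t = 1"
  then obtain x A y B where ab: "a = (x, A)" "b = (y, B)"
    and A: "admissible_moments x A" and B: "admissible_moments y B" by auto
  have t: "t = 1 - s" using st by simp
  have "C *v (s *\<^sub>R x + t *\<^sub>R y - \<mu>) = s *\<^sub>R (C *v (x - \<mu>)) + t *\<^sub>R (C *v (y - \<mu>))"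
    by (simp add: t matrix_vector_right_distrib matrix_vector_mult_diff_distrib
        matrix_vector_mult_scaleR algebra_simps)
  also have "norm \<dots> \<le> s * norm (C *v (x - \<mu>)) + t * norm (C *v (y - \<mu>))"
    using st by (intro norm_triangle_le) simp
  also have "\<dots> \<le> s * sqrt \<gamma>1 + t * sqrt \<gamma>1"
    using A B st unfolding admissible_moments_def by (intro add_mono mult_left_mono) auto
  also have "\<dots> = sqrt \<gamma>1" by (simp add: t algebra_simps)
  finally have n: "norm (C *v (s *\<^sub>R x + t *\<^sub>R y - \<mu>)) \<le> sqrt \<gamma>1" .
  have "\<gamma>2 *\<^sub>R \<Sigma> - ((s *\<^sub>R A + t *\<^sub>R B) - outer \<mu> (s *\<^sub>R x + t *\<^sub>R y) - outer (s *\<^sub>R x + t *\<^sub>R y) \<mu> + outer \<mu> \<mu>)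
     = s *\<^sub>R (\<gamma>2 *\<^sub>R \<Sigma> - (A - outer \<mu> x - outer x \<mu> + outer \<mu> \<mu>))
       + t *\<^sub>R (\<gamma>2 *\<^sub>R \<Sigma> - (B - outer \<mu> y - outer y \<mu> + outer \<mu> \<mu>))"
    by (simp add: t outer_linear algebra_simps)
  also have "psd \<dots>" using A B st unfolding admissible_moments_def
    by (intro psd_add psd_scaleR) auto
  finally show "s *\<^sub>R a + t *\<^sub>R b \<in> {(x, A). admissible_moments x A}"
    using n by (simp add: ab admissible_moments_def)
qed

lemma closed_admissible: "closed {(x, A). admissible_moments x A}"
proof -
  have C: "continuous_on UNIV (\<lambda>z::(real^'d) \<times> (real^'d^'d). norm (C *v (fst z - \<mu>)))"
    by (intro continuous_intros continuous_on_compose2[OF linear_continuous_on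
        [OF linear_conv_bounded_linear[THEN iffD1, OF matrix_vector_mul_linear]]]) auto
  have "continuous_on UNIV (\<lambda>z. \<gamma>2 *\<^sub>R \<Sigma> - (snd z - outer \<mu> (fst z) - outer (fst z) \<mu> + outer \<mu> \<mu>))"
    by (intro continuous_intros bounded_linear.continuous_on[OF bounded_linear_outer_right]
        bounded_linear.continuous_on[OF bounded_linear_outer_left])
  then have "closed ((\<lambda>z. \<gamma>2 *\<^sub>R \<Sigma> - (snd z - outer \<mu> (fst z) - outer (fst z) \<mu> + outer \<mu> \<mu>)) -` {A. psd A})"
    by (intro closed_vimage closed_psd)
  with C have "closed {z. norm (C *v (fst z - \<mu>)) \<le> sqrt \<gamma>1 \<and>
      psd (\<gamma>2 *\<^sub>R \<Sigma> - (snd z - outer \<mu> (fst z) - outer (fst z) \<mu> + outer \<mu> \<mu>))}"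
    by (intro closed_Collect_conj closed_Collect_le) (simp_all add: vimage_def continuous_intros)
  moreover have "{(x, A). admissible_moments x A} = {z. norm (C *v (fst z - \<mu>)) \<le> sqrt \<gamma>1 \<and>
      psd (\<gamma>2 *\<^sub>R \<Sigma> - (snd z - outer \<mu> (fst z) - outer (fst z) \<mu> + outer \<mu> \<mu>))}"
    by (auto simp: admissible_moments_def)
  ultimately show ?thesis by (simp only:)
qed

text \<open>A law on the box with a label 0 or 1 attached to its points has the moment vector \<open>(p, b, x, A)\<close>:
  \<open>p\<close> is the mass of the label 1, \<open>b\<close> the integral of \<open>v \<bullet> u - t\<close> over that part, and \<open>(x, A)\<close> the
  moments of the whole law. A vector with \<open>p \<ge> \<epsilon>\<close>, \<open>b \<ge> 0\<close> and admissible \<open>(x, A)\<close> would yield,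
  by taking the mean of each part, a point \<open>u\<close> of the uncertainty set with \<open>v \<bullet> u \<ge> t\<close>. Hence the
  two convex sets are disjoint. The coordinates of a separating functional are the multipliers; their
  signs are forced by the directions in which the second set recedes.\<close>

lemma separating_multipliers:
  assumes \<epsilon>: "0 < \<epsilon>" "\<epsilon> < 1" and ne: "{lo..hi} \<noteq> {}"
    and none: "\<And>u. u \<in> U_DY lo hi \<mu> \<Sigma> C \<gamma>1 \<gamma>2 \<epsilon> \<Longrightarrow> v \<bullet> u < t"
  obtains r \<theta> a q Z where "psd Z" "0 \<le> \<theta>" "0 \<le> a" "r + worst_case_moment q Z < \<theta> * \<epsilon>"
    "\<forall>u\<in>{lo..hi}. 0 \<le> r + q \<bullet> u + u \<bullet> (Z *v u)"
    "\<forall>u\<in>{lo..hi}. \<theta> + a * (v \<bullet> u - t) \<le> r + q \<bullet> u + u \<bullet> (Z *v u)"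
proof -
  define pt where "pt k z = (k, k * (v \<bullet> fst z - t), z)" for k :: real and z :: "(real^'d) \<times> (real^'d^'d)"
  define D where "D = {(m, A) |m A. m \<in> {lo..hi} \<and> psd (A - outer m m)}"
  define Y where "Y k = (\<lambda>u. pt k (u, outer u u)) ` {lo..hi}" for k
  define H where "H = {\<epsilon>..} \<times> ({0..} :: real set) \<times> {(x, A). admissible_moments x A}"
  have cont: "continuous_on {lo..hi} (\<lambda>u. pt k (u, outer u u))" for k
    unfolding pt_def by (intro continuous_intros continuous_on_subset[OF continuous_outer]) auto
  have "compact (Y k)" for k
    unfolding Y_def by (intro compact_continuous_image cont compact_box)
  then have compact: "compact (convex hull (Y 0 \<union> Y 1))"
    by (intro compact_convex_hull compact_Un)
  have nonempty: "convex hull (Y 0 \<union> Y 1) \<noteq> {}" using ne by (simp add: Y_def)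
  have H: "convex H" "closed H"
    unfolding H_def by (intro convex_Times closed_Times convex_admissible closed_admissible; simp)+
  have "convex (pt k ` D)" for k
  proof (rule convexI)
    fix a b s s' assume "a \<in> pt k ` D" "b \<in> pt k ` D" and s: "0 \<le> s" "0 \<le> s'" "s + s' = (1::real)"
    then obtain y z where y: "y \<in> D" "a = pt k y" and z: "z \<in> D" "b = pt k z" by blast
    have "s *\<^sub>R y + s' *\<^sub>R z \<in> D"
      using convexD[OF convex_dominated_moments] y z s unfolding D_def by blast
    moreover have s': "s' = 1 - s" using s by simp
    have "s *\<^sub>R a + s' *\<^sub>R b = pt k (s *\<^sub>R y + s' *\<^sub>R z)"
      unfolding y z s' by (simp add: pt_def inner_add_right algebra_simps)
    ultimately show "s *\<^sub>R a + s' *\<^sub>R b \<in> pt k ` D" by blast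
  qed
  moreover have YD: "Y k \<subseteq> pt k ` D" for k
    by (auto simp: Y_def D_def psd_zero)
  moreover have "D \<noteq> {}" using YD[of 0] ne by (auto simp: Y_def)
  ultimately have hull: "convex hull (pt 0 ` D \<union> pt 1 ` D)
      = {a *\<^sub>R y + b *\<^sub>R z |a b y z. 0 \<le> a \<and> 0 \<le> b \<and> a + b = 1 \<and> y \<in> pt 0 ` D \<and> z \<in> pt 1 ` D}"
    by (subst convex_hull_union_two) auto
  have disjoint: "convex hull (Y 0 \<union> Y 1) \<inter> H = {}"
  proof (rule ccontr)
    assume "convex hull (Y 0 \<union> Y 1) \<inter> H \<noteq> {}"
    moreover have "convex hull (Y 0 \<union> Y 1) \<subseteq> convex hull (pt 0 ` D \<union> pt 1 ` D)"
      by (intro hull_mono Un_mono YD)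
    ultimately obtain a p y z where p: "0 \<le> a" "0 \<le> p" "a + p = 1" and yz: "y \<in> D" "z \<in> D"
      and inH: "a *\<^sub>R pt 0 y + p *\<^sub>R pt 1 z \<in> H"
      unfolding hull by blast
    have a: "a = 1 - p" using p by simp
    obtain m A u B where y: "y = (m, A)" "m \<in> {lo..hi}" "psd (A - outer m m)"
      and z: "z = (u, B)" "u \<in> {lo..hi}" "psd (B - outer u u)"
      using yz by (auto simp: D_def)
    have pe: "\<epsilon> \<le> p" and pv: "0 \<le> p * (v \<bullet> u - t)"
      and adm: "admissible_moments (p *\<^sub>R u + (1 - p) *\<^sub>R m) (p *\<^sub>R B + (1 - p) *\<^sub>R A)"
      using inH by (simp_all add: H_def pt_def y z a add.commute)
    have "(p *\<^sub>R B + (1 - p) *\<^sub>R A) - (p *\<^sub>R outer u u + (1 - p) *\<^sub>R outer m m)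
        = p *\<^sub>R (B - outer u u) + (1 - p) *\<^sub>R (A - outer m m)" by (simp add: algebra_simps)
    also have "psd \<dots>" using y z p by (intro psd_add psd_scaleR) auto
    finally have "admissible_two_point p u m"
      unfolding admissible_two_point_def by (rule admissible_moments_mono[OF adm])
    then have "u \<in> U_DY lo hi \<mu> \<Sigma> C \<gamma>1 \<gamma>2 \<epsilon>"
      using y z p pe by (subst in_U_DY_iff[OF \<epsilon>]) auto
    then have "v \<bullet> u < t" by (rule none)
    then have "p * (v \<bullet> u - t) < 0" using pe \<epsilon> by (intro mult_pos_neg) auto
    with pv show False by simp
  qed
  obtain f r where f: "\<And>y. y \<in> convex hull (Y 0 \<union> Y 1) \<Longrightarrow> f \<bullet> y < r" "\<And>h. h \<in> H \<Longrightarrow> r < f \<bullet> h"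
    using separating_hyperplane_compact_closed[OF convex_convex_hull compact nonempty H disjoint]
    by blast
  obtain \<theta> a q' W where fe: "f = (\<theta>, a, q', W)" by (metis prod.collapse)
  \<comment> \<open>Only symmetric matrices occur below, so the functional \<open>W\<close> may be replaced by its symmetric
     part; the sign makes \<open>Z\<close> the matrix of the quadratic \<open>g\<close>.\<close>
  define q where "q = - q'"
  define Z where "Z = - (1/2) *\<^sub>R (W + transpose W)"
  have symZ: "transpose Z = Z"
    by (simp add: Z_def transpose_scaleR transpose_add add.commute flip: scaleR_minus_left)
  have WZ: "W \<bullet> A = - (A \<bullet> Z)" if "transpose A = A" for A
    using transpose_inner[of W A] that
    by (simp add: Z_def inner_add_left inner_add_right inner_commute[of A])
  have onY: "\<theta> * k + a * (k * (v \<bullet> u - t)) < r + q \<bullet> u + u \<bullet> (Z *v u)"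
    if "u \<in> {lo..hi}" "k \<in> {0, 1}" for k u
  proof -
    have "pt k (u, outer u u) \<in> convex hull (Y 0 \<union> Y 1)"
      using that by (intro hull_inc) (auto simp: Y_def)
    from f(1)[OF this] show ?thesis
      by (simp add: fe pt_def WZ transpose_outer outer_inner q_def)
  qed
  have onH: "r < \<theta> * p + a * b - q \<bullet> x - A \<bullet> Z"
    if "\<epsilon> \<le> p" "0 \<le> b" "admissible_moments x A" "transpose A = A" for p b x A
    using f(2)[of "(p, b, x, A)"] that by (simp add: H_def fe q_def WZ)
  obtain x A where xA: "admissible_moments x A" "transpose A = A"
    "A \<bullet> Z + q \<bullet> x = worst_case_moment q Z"
    using worst_case_moment_attained[OF symZ] .
  have "r < (\<theta> * \<epsilon> - q \<bullet> x - A \<bullet> Z) + k * \<theta>" if "0 \<le> k" for k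
    using onH[of "\<epsilon> + k" 0, OF _ _ xA(1,2)] that by (simp add: algebra_simps)
  then have \<theta>: "0 \<le> \<theta>" by (rule nonneg_of_ray_bounded_below)
  have "r < (\<theta> * \<epsilon> - q \<bullet> x - A \<bullet> Z) + k * a" if "0 \<le> k" for k
    using onH[of \<epsilon> k, OF _ _ xA(1,2)] that by (simp add: algebra_simps)
  then have a: "0 \<le> a" by (rule nonneg_of_ray_bounded_below)
  have "psd Z" unfolding psd_def
  proof (intro conjI allI symZ)
    fix w
    have "r < (\<theta> * \<epsilon> - q \<bullet> x - A \<bullet> Z) + k * (w \<bullet> (Z *v w))" if "0 \<le> k" for k
    proof -
      have "admissible_moments x (A - k *\<^sub>R outer w w)"
        using that by (intro admissible_moments_mono[OF xA(1)]) (simp add: psd_scaleR psd_outer)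
      from onH[of \<epsilon> 0, OF _ _ this] xA(2) show ?thesis
        by (simp add: transpose_diff transpose_scaleR transpose_outer inner_diff_left outer_inner)
    qed
    then show "0 \<le> w \<bullet> (Z *v w)" by (rule nonneg_of_ray_bounded_below)
  qed
  moreover have "r + worst_case_moment q Z < \<theta> * \<epsilon>"
    using onH[of \<epsilon> 0, OF _ _ xA(1,2)] xA(3) by simp
  moreover have "0 \<le> r + q \<bullet> u + u \<bullet> (Z *v u)" if "u \<in> {lo..hi}" for u
    using onY[OF that, of 0] by simp
  moreover have "\<theta> + a * (v \<bullet> u - t) \<le> r + q \<bullet> u + u \<bullet> (Z *v u)" if "u \<in> {lo..hi}" for u
    using onY[OF that, of 1] by simp
  ultimately show ?thesis using that \<theta> a by blast
qed

text \<open>If the multiplier \<open>a\<close> of \<open>v \<bullet> u - t\<close> is positive, scale the separating solution by \<open>1 / a\<close>. If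
  \<open>a = 0\<close>, the solution is a ray: a large multiple of it, with strict slack in the moment constraint,
  absorbs the constant \<open>e\<close> that makes \<open>e \<ge> v \<bullet> u - t\<close> on the whole box. On an empty box the zero
  quadratic is feasible.\<close>

lemma strong_duality:
  assumes \<epsilon>: "0 < \<epsilon>" "\<epsilon> < 1"
    and none: "\<And>u. u \<in> U_DY lo hi \<mu> \<Sigma> C \<gamma>1 \<gamma>2 \<epsilon> \<Longrightarrow> v \<bullet> u < t"
  shows "t \<in> dual_DY lo hi \<mu> \<Sigma> \<gamma>1 \<gamma>2 \<epsilon> v"
proof (cases "{lo..hi} = {}")
  case True
  have "worst_case_moment 0 0 = 0" using worst_case_moment_scale[of 0 0 0] by simp
  then show ?thesis using True unfolding in_dual_DY_iff
    by (intro exI[of _ 0]) (simp add: psd_zero)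
next
  case False
  obtain r \<theta> a q Z where Z: "psd Z" "0 \<le> \<theta>" "0 \<le> a"
    and rs: "r + worst_case_moment q Z < \<theta> * \<epsilon>"
    and g1: "\<forall>u\<in>{lo..hi}. 0 \<le> r + q \<bullet> u + u \<bullet> (Z *v u)"
    and g2: "\<forall>u\<in>{lo..hi}. \<theta> + a * (v \<bullet> u - t) \<le> r + q \<bullet> u + u \<bullet> (Z *v u)"
    using separating_multipliers[OF \<epsilon> False none] by metis
  obtain k e where k: "0 \<le> k" "0 \<le> e" "k * (r + worst_case_moment q Z) + e \<le> k * (\<theta> * \<epsilon>)"
    and ke: "\<And>u. u \<in> {lo..hi} \<Longrightarrow> v \<bullet> u - t \<le> k * (a * (v \<bullet> u - t)) + e"
  proof (cases "a = 0")
    case False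
    with Z(3) rs show ?thesis
      by (intro that[of "1 / a" 0]) (simp_all add: divide_right_mono)
  next
    case True
    have "compact ((\<lambda>u. v \<bullet> u) ` {lo..hi})"
      by (intro compact_continuous_image continuous_intros compact_box)
    then obtain b where b: "\<And>u. u \<in> {lo..hi} \<Longrightarrow> \<bar>v \<bullet> u\<bar> \<le> b"
      using compact_imp_bounded by (fastforce simp: bounded_iff)
    define e where "e = \<bar>b\<bar> + \<bar>t\<bar>"
    define k where "k = e / (\<theta> * \<epsilon> - (r + worst_case_moment q Z))"
    have k: "0 \<le> k" using rs by (simp add: k_def e_def)
    have "k * (\<theta> * \<epsilon> - (r + worst_case_moment q Z)) = e" using rs by (simp add: k_def)
    then have "k * (r + worst_case_moment q Z) + e \<le> k * (\<theta> * \<epsilon>)" by (simp add: algebra_simps)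
    moreover have "v \<bullet> u - t \<le> e" if "u \<in> {lo..hi}" for u
      using b[OF that] by (simp add: e_def)
    ultimately show ?thesis using k True by (intro that[of k e]) (simp_all add: e_def)
  qed
  have mv: "r' + (k *\<^sub>R q) \<bullet> u + u \<bullet> ((k *\<^sub>R Z) *v u)
      = k * (r + q \<bullet> u + u \<bullet> (Z *v u)) + e" if "r' = k * r + e" for r' u
    by (simp add: that scaleR_mv algebra_simps)
  show ?thesis unfolding in_dual_DY_iff
  proof (rule exI[of _ "k * r + e"], rule exI[of _ "k * \<theta>"], rule exI[of _ "k *\<^sub>R q"],
      rule exI[of _ "k *\<^sub>R Z"], intro conjI ballI)
    show "psd (k *\<^sub>R Z)" "0 \<le> k * \<theta>" using Z k by (simp_all add: psd_scaleR)
    show "k * r + e + worst_case_moment (k *\<^sub>R q) (k *\<^sub>R Z) \<le> k * \<theta> * \<epsilon>"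
      using k by (simp add: worst_case_moment_scale algebra_simps)
    fix u assume u: "u \<in> {lo..hi}"
    show "0 \<le> k * r + e + (k *\<^sub>R q) \<bullet> u + u \<bullet> ((k *\<^sub>R Z) *v u)"
      unfolding mv[OF refl] using g1 u k by simp
    have "k * \<theta> + k * (a * (v \<bullet> u - t)) \<le> k * (r + q \<bullet> u + u \<bullet> (Z *v u))"
      using mult_left_mono[OF bspec[OF g2 u] k(1)] by (simp add: algebra_simps)
    then show "k * \<theta> + (v \<bullet> u - t) \<le> k * r + e + (k *\<^sub>R q) \<bullet> u + u \<bullet> ((k *\<^sub>R Z) *v u)"
      unfolding mv[OF refl] using ke[OF u] by simp
  qed
qed

lemma support_fun_eq_dual:
  assumes \<epsilon>: "0 < \<epsilon>" "\<epsilon> < 1"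
  shows "support_fun v (U_DY lo hi \<mu> \<Sigma> C \<gamma>1 \<gamma>2 \<epsilon>) = (INF t \<in> dual_DY lo hi \<mu> \<Sigma> \<gamma>1 \<gamma>2 \<epsilon> v. ereal t)"
proof (rule antisym)
  show "support_fun v (U_DY lo hi \<mu> \<Sigma> C \<gamma>1 \<gamma>2 \<epsilon>) \<le> (INF t \<in> dual_DY lo hi \<mu> \<Sigma> \<gamma>1 \<gamma>2 \<epsilon> v. ereal t)"
    unfolding support_fun_def
    by (intro SUP_least INF_greatest) (simp add: weak_duality[OF \<epsilon>])
  show "(INF t \<in> dual_DY lo hi \<mu> \<Sigma> \<gamma>1 \<gamma>2 \<epsilon> v. ereal t) \<le> support_fun v (U_DY lo hi \<mu> \<Sigma> C \<gamma>1 \<gamma>2 \<epsilon>)"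
  proof (rule ccontr)
    assume "\<not> ?thesis"
    then obtain t where t: "support_fun v (U_DY lo hi \<mu> \<Sigma> C \<gamma>1 \<gamma>2 \<epsilon>) < ereal t"
      "ereal t < (INF t \<in> dual_DY lo hi \<mu> \<Sigma> \<gamma>1 \<gamma>2 \<epsilon> v. ereal t)"
      by (meson ereal_dense2 not_le)
    have "v \<bullet> u < t" if "u \<in> U_DY lo hi \<mu> \<Sigma> C \<gamma>1 \<gamma>2 \<epsilon>" for u
      using t(1) SUP_upper[OF that, of "\<lambda>u. ereal (v \<bullet> u)"] unfolding support_fun_def
      by (metis le_less_trans less_ereal.simps(1))
    then have "t \<in> dual_DY lo hi \<mu> \<Sigma> \<gamma>1 \<gamma>2 \<epsilon> v" by (rule strong_duality[OF \<epsilon>])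
    then have "(INF t \<in> dual_DY lo hi \<mu> \<Sigma> \<gamma>1 \<gamma>2 \<epsilon> v. ereal t) \<le> ereal t" by (rule INF_lower)
    with t(2) show False by simp
  qed
qed

lemma support_fun_eq_VaR:
  assumes \<epsilon>: "0 < \<epsilon>" "\<epsilon> < 1"
  shows "support_fun v (U_DY lo hi \<mu> \<Sigma> C \<gamma>1 \<gamma>2 \<epsilon>)
     = (SUP Q \<in> P_DY lo hi \<mu> \<Sigma> \<gamma>1 \<gamma>2. ereal (VaR \<epsilon> Q v))"
  using support_fun_le_VaR[OF \<epsilon>] VaR_le_support_fun[OF \<epsilon>]
  by (intro antisym SUP_least)

end

theorem theorem12:
  fixes M :: "'a measure"
    and P :: "(real^'d) measure"
    and N :: nat
    and X :: "nat \<Rightarrow> 'a \<Rightarrow> real^'d"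
    and lo hi :: "real^'d"
    and \<alpha> :: real
    and \<mu> :: "'a \<Rightarrow> real^'d"
    and \<Sigma> C :: "'a \<Rightarrow> real^'d^'d"
    and \<gamma>1 \<gamma>2 :: "'a \<Rightarrow> real"
  assumes "prob_space M"
    and "prob_space P" and "sets P = sets borel"
    and "prob_space.indep_vars M (\<lambda>_. borel) X {..<N}"
    and "\<And>i. i < N \<Longrightarrow> distr M borel (X i) = P"
    and "0 < \<alpha>" and "\<alpha> < 1"
    and "\<mu> = sample_mean N X" and "\<Sigma> = sample_cov N X"
    and "\<And>\<omega>. \<omega> \<in> space M \<Longrightarrow> invertible (\<Sigma> \<omega>) \<Longrightarrow> transpose (C \<omega>) ** C \<omega> = matrix_inv (\<Sigma> \<omega>)"
    and "\<And>\<omega>. \<omega> \<in> space M \<Longrightarrow> 0 \<le> \<gamma>1 \<omega>"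
    and "with_prob_at_least M (1 - \<alpha>)
           (\<lambda>\<omega>. invertible (\<Sigma> \<omega>) \<and> P \<in> P_DY lo hi (\<mu> \<omega>) (\<Sigma> \<omega>) (\<gamma>1 \<omega>) (\<gamma>2 \<omega>))"
    and "msupp P \<subseteq> {lo..hi}"
  shows "with_prob_at_least M (1 - \<alpha>)
           (\<lambda>\<omega>. invertible (\<Sigma> \<omega>) \<and> simultaneously_implies_guarantee TYPE('k::finite) P
              (U_DY lo hi (\<mu> \<omega>) (\<Sigma> \<omega>) (C \<omega>) (\<gamma>1 \<omega>) (\<gamma>2 \<omega>)))
       \<and> (\<forall>\<omega>\<in>space M. invertible (\<Sigma> \<omega>) \<longrightarrow> (\<forall>\<epsilon> v. 0 < \<epsilon> \<and> \<epsilon> < 1 \<longrightarrow>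
            support_fun v (U_DY lo hi (\<mu> \<omega>) (\<Sigma> \<omega>) (C \<omega>) (\<gamma>1 \<omega>) (\<gamma>2 \<omega>) \<epsilon>)
              = (SUP Q \<in> P_DY lo hi (\<mu> \<omega>) (\<Sigma> \<omega>) (\<gamma>1 \<omega>) (\<gamma>2 \<omega>). ereal (VaR \<epsilon> Q v))
          \<and> (SUP Q \<in> P_DY lo hi (\<mu> \<omega>) (\<Sigma> \<omega>) (\<gamma>1 \<omega>) (\<gamma>2 \<omega>). ereal (VaR \<epsilon> Q v))
              = (INF t \<in> dual_DY lo hi (\<mu> \<omega>) (\<Sigma> \<omega>) (\<gamma>1 \<omega>) (\<gamma>2 \<omega>) \<epsilon> v. ereal t)))"
proof (intro conjI ballI impI allI)
  have factored: "factored_covariance (\<Sigma> \<omega>) (C \<omega>) (\<gamma>1 \<omega>)"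
    if "\<omega> \<in> space M" "invertible (\<Sigma> \<omega>)" for \<omega>
    using that assms(10,11) by unfold_locales auto
  obtain E where E: "E \<in> sets M" "1 - \<alpha> \<le> measure M E"
    and valid: "\<And>\<omega>. \<omega> \<in> E \<Longrightarrow> invertible (\<Sigma> \<omega>) \<and> P \<in> P_DY lo hi (\<mu> \<omega>) (\<Sigma> \<omega>) (\<gamma>1 \<omega>) (\<gamma>2 \<omega>)"
    using assms(12) unfolding with_prob_at_least_def by blast
  have "invertible (\<Sigma> \<omega>) \<and> simultaneously_implies_guarantee TYPE('k) P
      (U_DY lo hi (\<mu> \<omega>) (\<Sigma> \<omega>) (C \<omega>) (\<gamma>1 \<omega>) (\<gamma>2 \<omega>))" if "\<omega> \<in> E" for \<omega>
  proof -
    have "\<omega> \<in> space M" using E(1) that sets.sets_into_space by blast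
    then interpret factored_covariance "\<mu> \<omega>" "\<Sigma> \<omega>" "C \<omega>" "\<gamma>1 \<omega>" "\<gamma>2 \<omega>" lo hi
      using factored valid[OF that] by blast
    show ?thesis
      using valid[OF that] U_DY_implies_guarantee
      unfolding simultaneously_implies_guarantee_def by blast
  qed
  with E show "with_prob_at_least M (1 - \<alpha>)
      (\<lambda>\<omega>. invertible (\<Sigma> \<omega>) \<and> simultaneously_implies_guarantee TYPE('k) P
         (U_DY lo hi (\<mu> \<omega>) (\<Sigma> \<omega>) (C \<omega>) (\<gamma>1 \<omega>) (\<gamma>2 \<omega>)))"
    unfolding with_prob_at_least_def by blast
  fix \<omega> \<epsilon> v
  assume \<omega>: "\<omega> \<in> space M" "invertible (\<Sigma> \<omega>)" and \<epsilon>: "0 < \<epsilon> \<and> \<epsilon> < (1::real)"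
  interpret factored_covariance "\<mu> \<omega>" "\<Sigma> \<omega>" "C \<omega>" "\<gamma>1 \<omega>" "\<gamma>2 \<omega>" lo hi
    using factored[OF \<omega>] .
  show VaR: "support_fun v (U_DY lo hi (\<mu> \<omega>) (\<Sigma> \<omega>) (C \<omega>) (\<gamma>1 \<omega>) (\<gamma>2 \<omega>) \<epsilon>)
      = (SUP Q \<in> P_DY lo hi (\<mu> \<omega>) (\<Sigma> \<omega>) (\<gamma>1 \<omega>) (\<gamma>2 \<omega>). ereal (VaR \<epsilon> Q v))"
    using \<epsilon> by (intro support_fun_eq_VaR) auto
  show "(SUP Q \<in> P_DY lo hi (\<mu> \<omega>) (\<Sigma> \<omega>) (\<gamma>1 \<omega>) (\<gamma>2 \<omega>). ereal (VaR \<epsilon> Q v))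
      = (INF t \<in> dual_DY lo hi (\<mu> \<omega>) (\<Sigma> \<omega>) (\<gamma>1 \<omega>) (\<gamma>2 \<omega>) \<epsilon> v. ereal t)"
    unfolding VaR[symmetric] using \<epsilon> by (intro support_fun_eq_dual) auto
qed

end
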